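(* Let $\mathcal F$ be any $m$-dimensional function space and let $n>m$ be an integer. There are at most $n$ points and positive weights whose normal matrix $\boldsymbol M$ satisfies, for every $0<\delta<1$, $$n_{\rm iter}(\boldsymbol M)\le\left\lceil\frac{2\log(\delta/2)}{\log(m/n)}\right\rceil.$$
   Context: A function space here is an $m$-dimensional complex subspace $\mathcal F\subseteq L_2(\Omega,\nu)$, for a measure space $(\Omega,\nu)$, on which pointwise function evaluations are well-defined (i.e. the elements are genuine functions $\Omega\to\mathbb C$ and $\|\cdot\|_{L_2}$ is a norm on $\mathcal F$). Normal matrix: given an orthonormal basis $\eta_1,\dots,\eta_m$ of $\mathcal F$, distinct points $x_1,\dots,x_k\in\Omega$ and weights $w_1,\dots,w_k>0$, let $\boldsymbol\eta(x)=[\eta_1(x),\dots,\eta_m(x)]^\ast$ (conjugate-transposed row, a column vector) and $\boldsymbol M=\sum_{i=1}^kw_i\boldsymbol\eta(x_i)\boldsymbol\eta(x_i)^\ast\in\mathbb C^{m\times m}$. For positive definite $\boldsymbol M$ let $\kappa(\boldsymbol M)=\lambda_{\max}(\boldsymbol M)/\lambda_{\min}(\boldsymbol M)$ and $q(\boldsymbol M)=\frac{\sqrt{\kappa(\boldsymbol M)}-1}{\sqrt{\kappa(\boldsymbol M)}+1}$. For $0<\delta<1$, the certified iteration count is $n_{\rm iter}(\boldsymbol M)=\min\{i\in\mathbb N_0:2q(\boldsymbol M)^i\le\delta\}$ (with $0^0=1$). The assertion includes that $\boldsymbol M$ is positive definite, so that $n_{\rm iter}(\boldsymbol M)$ is defined.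 *)

theory Defs
  imports
    "HOL-Library.Function_Algebras"
    "HOL-Analysis.Analysis"
    "Jordan_Normal_Form.Spectral_Radius"
begin

definition cfun_scale :: "complex \<Rightarrow> ('a \<Rightarrow> complex) \<Rightarrow> 'a \<Rightarrow> complex" where
  "cfun_scale c f = (\<lambda>x. c * f x)"

interpretation cfun: vector_space "cfun_scale :: complex \<Rightarrow> ('a \<Rightarrow> complex) \<Rightarrow> 'a \<Rightarrow> complex"
  by unfold_locales (auto simp: cfun_scale_def fun_eq_iff algebra_simps)

definition l2_inner :: "'a measure \<Rightarrow> ('a \<Rightarrow> complex) \<Rightarrow> ('a \<Rightarrow> complex) \<Rightarrow> complex" where
  "l2_inner \<nu> f g = (\<integral>x. f x * cnj (g x) \<partial>\<nu>)"

definition l2_norm :: "'a measure \<Rightarrow> ('a \<Rightarrow> complex) \<Rightarrow> real" where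
  "l2_norm \<nu> f = sqrt (\<integral>x. (cmod (f x))\<^sup>2 \<partial>\<nu>)"

text \<open>
  The domain is \<open>space \<nu>\<close>. A function on it is represented by its extension by zero
  to the whole type, so that equality on \<open>space \<nu>\<close> is equality in HOL.
  The elements are functions, not classes modulo null sets: the last conjunct says
  that the (semi)norm of \<open>L\<^sub>2\<close> separates them. The finite spanning set is
  required because \<open>cfun.dim\<close> is \<open>0\<close> on infinite-dimensional spaces.
\<close>

definition function_space :: "'a measure \<Rightarrow> nat \<Rightarrow> ('a \<Rightarrow> complex) set \<Rightarrow> bool" where
  "function_space \<nu> m F \<longleftrightarrow>
     cfun.subspace F \<and>
     (\<exists>B. finite B \<and> cfun.span B = F) \<and>
     cfun.dim F = m \<and>
     (\<forall>f\<in>F. \<forall>x. x \<notin> space \<nu> \<longrightarrow> f x = 0) \<and>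
     (\<forall>f\<in>F. f \<in> borel_measurable \<nu> \<and> integrable \<nu> (\<lambda>x. (cmod (f x))\<^sup>2)) \<and>
     (\<forall>f\<in>F. l2_norm \<nu> f = 0 \<longrightarrow> f = 0)"

definition orthonormal_basis ::
    "'a measure \<Rightarrow> nat \<Rightarrow> ('a \<Rightarrow> complex) set \<Rightarrow> (nat \<Rightarrow> 'a \<Rightarrow> complex) \<Rightarrow> bool" where
  "orthonormal_basis \<nu> m F \<eta> \<longleftrightarrow>
     (\<forall>i<m. \<eta> i \<in> F) \<and>
     (\<forall>i<m. \<forall>j<m. l2_inner \<nu> (\<eta> i) (\<eta> j) = (if i = j then 1 else 0)) \<and>
     cfun.span (\<eta> ` {..<m}) = F"

definition eval_vec :: "nat \<Rightarrow> (nat \<Rightarrow> 'a \<Rightarrow> complex) \<Rightarrow> 'a \<Rightarrow> complex vec" where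
  "eval_vec m \<eta> x = vec m (\<lambda>j. cnj (\<eta> j x))"

text \<open>
  The sum of the rank-one matrices \<open>w i *\<close> \<open>v v\<^sup>*\<close>, \<open>v = eval_vec m \<eta> (x i)\<close>, is taken
  entrywise, since matrices carry their dimension as data and are not an instance of
  \<open>comm_monoid_add\<close>.
\<close>

definition normal_matrix ::
    "nat \<Rightarrow> (nat \<Rightarrow> 'a \<Rightarrow> complex) \<Rightarrow> nat \<Rightarrow> (nat \<Rightarrow> 'a) \<Rightarrow> (nat \<Rightarrow> real) \<Rightarrow> complex mat" where
  "normal_matrix m \<eta> k x w =
     mat m m (\<lambda>(a, b). \<Sum>i<k. complex_of_real (w i) *
       (vec_index (eval_vec m \<eta> (x i)) a * cnj (vec_index (eval_vec m \<eta> (x i)) b)))"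

definition positive_definite :: "complex mat \<Rightarrow> bool" where
  "positive_definite A \<longleftrightarrow>
     square_mat A \<and> mat_adjoint A = A \<and>
     (\<forall>v \<in> carrier_vec (dim_row A). v \<noteq> 0\<^sub>v (dim_row A) \<longrightarrow> 0 < Re ((A *\<^sub>v v) \<bullet>c v))"

text \<open>
  The next definitions are meant for positive definite matrices of positive dimension,
  whose eigenvalues are real and form a finite nonempty set.
\<close>

definition lambda_max :: "complex mat \<Rightarrow> real" where
  "lambda_max A = Max {t. eigenvalue A (complex_of_real t)}"

definition lambda_min :: "complex mat \<Rightarrow> real" where
  "lambda_min A = Min {t. eigenvalue A (complex_of_real t)}"

definition cond_number :: "complex mat \<Rightarrow> real" where
  "cond_number A = lambda_max A / lambda_min A"

definition cg_rate :: "complex mat \<Rightarrow> real" where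
  "cg_rate A = (sqrt (cond_number A) - 1) / (sqrt (cond_number A) + 1)"

definition n_iter :: "real \<Rightarrow> complex mat \<Rightarrow> nat" where
  "n_iter \<delta> A = (LEAST i. 2 * cg_rate A ^ i \<le> \<delta>)"

end

theory Submission
  imports Defs
begin

text \<open>
  Since \<open>2 q\<^sup>i \<le> \<delta>\<close> as soon as \<open>q \<le> \<surd>(m/n)\<close> and \<open>i \<ge> 2 ln (\<delta>/2) / ln (m/n)\<close>, it suffices to
  find at most \<open>n\<close> weighted points for which \<open>\<kappa>(M) \<le> ((r + 1) / (r - 1))\<^sup>2\<close>, where
  \<open>r = \<surd>(n/m)\<close>. This is the bound of Batson, Spielman and Srivastava for spectral
  sparsifiers, and their barrier method proves it, with the average over finitely
  many vectors replaced by the integral over the measure: orthonormality of \<open>\<eta>\<close> says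
  that the rank-one matrices \<open>v v\<^sup>*\<close>, \<open>v = \<eta>(x)\<close>, integrate to the identity
  (\<open>isotropic\<close>).

  The points are chosen one at a time. The current matrix \<open>M\<close> is kept strictly between
  \<open>l I\<close> and \<open>u I\<close>, and the potentials \<open>tr (u I - M)\<^sup>-\<^sup>1\<close> and \<open>tr (M - l I)\<^sup>-\<^sup>1\<close> are kept
  below fixed bounds. In each step \<open>u\<close> and \<open>l\<close> grow by fixed amounts and
  \<open>t v v\<^sup>*\<close> is added to \<open>M\<close>. By the Sherman--Morrison formula the potentials do not
  increase if \<open>1/t\<close> lies between two quadratic forms in \<open>v\<close>
  (\<open>upper_barrier_step\<close>, \<open>lower_barrier_step\<close>). The integrals of these forms over all
  points are traces, which the resolvent identity compares (\<open>upper_average\<close>,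
  \<open>lower_average\<close>); therefore at some point the form that must be the smaller one is
  the smaller one (\<open>barrier_step\<close>). After \<open>n\<close> steps \<open>u/l\<close> equals the bound on \<open>\<kappa>(M)\<close> above
  (\<open>isotropic_sparsification\<close>).

  The result is the inequality
  \<open>l \<parallel>f\<parallel>\<^sup>2 \<le> (\<Sum>i. w\<^sub>i \<bar>f x\<^sub>i\<bar>\<^sup>2) \<le> u \<parallel>f\<parallel>\<^sup>2\<close> on the function space. It does not mention
  a basis, so the points and weights found with one orthonormal basis serve for all of
  them (\<open>orthonormal_basis_change\<close>).
\<close>

section \<open>Complex vectors and sesquilinear forms\<close>

lemma cip_sum:
  fixes v w :: "complex vec"
  assumes "w \<in> carrier_vec m"
  shows "v \<bullet>c w = (\<Sum>i<m. vec_index v i * cnj (vec_index w i))"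
  using assms by (auto simp: scalar_prod_def atLeast0LessThan)

lemma cip_add:
  fixes u v w :: "complex vec"
  assumes "u \<in> carrier_vec m" "v \<in> carrier_vec m" "w \<in> carrier_vec m"
  shows "(u + v) \<bullet>c w = u \<bullet>c w + v \<bullet>c w" "(u - v) \<bullet>c w = u \<bullet>c w - v \<bullet>c w"
    "w \<bullet>c (u + v) = w \<bullet>c u + w \<bullet>c v" "w \<bullet>c (u - v) = w \<bullet>c u - w \<bullet>c v"
  using assms
  by (simp_all add: cip_sum[of _ m] sum.distrib sum_subtractf algebra_simps)

lemma cip_smult:
  fixes v w :: "complex vec"
  assumes "v \<in> carrier_vec m" "w \<in> carrier_vec m"
  shows "(c \<cdot>\<^sub>v v) \<bullet>c w = c * (v \<bullet>c w)" "w \<bullet>c (c \<cdot>\<^sub>v v) = cnj c * (w \<bullet>c v)"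
  using assms by (simp_all add: cip_sum[of _ m] sum_distrib_left algebra_simps)

lemmas cip_linear = cip_add cip_smult

lemma cip_cnj:
  fixes v w :: "complex vec"
  assumes "v \<in> carrier_vec m" "w \<in> carrier_vec m"
  shows "cnj (v \<bullet>c w) = w \<bullet>c v"
  using assms by (simp add: cip_sum[of _ m] mult.commute)

text \<open>The squared Euclidean norm of a complex vector.\<close>
definition sq_norm :: "complex vec \<Rightarrow> real" where
  "sq_norm v = (\<Sum>i<dim_vec v. (cmod (vec_index v i))\<^sup>2)"

lemma cip_self: "v \<bullet>c v = complex_of_real (sq_norm v)"
proof -
  have "v \<bullet>c v = (\<Sum>i<dim_vec v. complex_of_real ((cmod (vec_index v i))\<^sup>2))"
    by (subst cip_sum[of v "dim_vec v"]) (auto simp only: complex_norm_square carrier_vec_dim_vec)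
  then show ?thesis by (simp add: sq_norm_def)
qed

lemma sq_norm_nonneg: "0 \<le> sq_norm v"
  by (simp add: sq_norm_def sum_nonneg)

lemma sq_norm_zero: "sq_norm (0\<^sub>v m) = 0"
  by (simp add: sq_norm_def)

lemma sq_norm_pos:
  assumes "v \<in> carrier_vec m" "v \<noteq> 0\<^sub>v m"
  shows "0 < sq_norm v"
proof -
  obtain i where "i < m" "vec_index v i \<noteq> 0"
    using assms by (auto simp: vec_eq_iff)
  then show ?thesis
    using assms unfolding sq_norm_def by (intro sum_pos2[of _ i]) auto
qed

lemma mult_mat_vec_sum:
  fixes A :: "complex mat"
  assumes "A \<in> carrier_mat m m" "v \<in> carrier_vec m" "a < m"
  shows "vec_index (A *\<^sub>v v) a = (\<Sum>b<m. A $$ (a, b) * vec_index v b)"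
  using assms by (auto simp: scalar_prod_def atLeast0LessThan)

lemma cip_mult_mat_vec_sum:
  fixes A :: "complex mat"
  assumes "A \<in> carrier_mat m m" "v \<in> carrier_vec m" "w \<in> carrier_vec m"
  shows "(A *\<^sub>v v) \<bullet>c w = (\<Sum>a<m. \<Sum>b<m. A $$ (a, b) * vec_index v b * cnj (vec_index w a))"
  using assms
  by (simp add: cip_sum[of _ m] mult_mat_vec_sum sum_distrib_right del: index_mult_mat_vec)

lemma cip_unit_vec:
  fixes v :: "complex vec"
  assumes "v \<in> carrier_vec m" "j < m"
  shows "v \<bullet>c unit_vec m j = vec_index v j"
  using assms by (simp add: cip_sum[of _ m] unit_vec_def if_distrib cong: if_cong)

lemma mult_mat_unit_vec:
  fixes A :: "complex mat"
  assumes "A \<in> carrier_mat m m" "a < m" "b < m"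
  shows "(A *\<^sub>v unit_vec m b) \<bullet>c unit_vec m a = A $$ (a, b)"
  using assms by (subst cip_unit_vec) auto

lemma sum_cip_unit_vec:
  assumes "v \<in> carrier_vec m"
  shows "(\<Sum>j<m. (cmod (v \<bullet>c unit_vec m j))\<^sup>2) = sq_norm v"
  using assms by (auto simp: cip_unit_vec sq_norm_def)

lemma mat_adjoint_carrier:
  fixes A :: "complex mat"
  assumes "A \<in> carrier_mat m m"
  shows "mat_adjoint A \<in> carrier_mat m m"
  unfolding mat_adjoint_def
  using mat_of_rows_carrier(1)[of "dim_row A" "map conjugate (cols A)"] assms
  by (simp del: mat_of_rows_carrier)

lemma mat_adjoint_index:
  fixes A :: "complex mat"
  assumes "A \<in> carrier_mat m m" "a < m" "b < m"
  shows "mat_adjoint A $$ (a, b) = cnj (A $$ (b, a))"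
  unfolding mat_adjoint_def using assms by (subst mat_of_rows_index) simp_all

lemma mat_adjoint_eq_iff:
  fixes A :: "complex mat"
  assumes "A \<in> carrier_mat m m"
  shows "mat_adjoint A = A \<longleftrightarrow> (\<forall>a<m. \<forall>b<m. A $$ (a, b) = cnj (A $$ (b, a)))"
  using assms mat_adjoint_carrier[OF assms] mat_adjoint_index[OF assms]
  unfolding mat_eq_iff by (metis carrier_matD)

lemma self_adjoint_iff:
  fixes A :: "complex mat"
  assumes A: "A \<in> carrier_mat m m"
  shows "mat_adjoint A = A \<longleftrightarrow>
    (\<forall>v\<in>carrier_vec m. \<forall>w\<in>carrier_vec m. (A *\<^sub>v v) \<bullet>c w = v \<bullet>c (A *\<^sub>v w))"
proof
  assume h: "mat_adjoint A = A"
  show "\<forall>v\<in>carrier_vec m. \<forall>w\<in>carrier_vec m. (A *\<^sub>v v) \<bullet>c w = v \<bullet>c (A *\<^sub>v w)"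
  proof (intro ballI)
    fix v w :: "complex vec" assume v: "v \<in> carrier_vec m" "w \<in> carrier_vec m"
    have "v \<bullet>c (A *\<^sub>v w) = cnj ((A *\<^sub>v w) \<bullet>c v)"
      using A v by (subst cip_cnj[of _ m]) auto
    also have "\<dots> = (\<Sum>b<m. \<Sum>a<m. cnj (A $$ (b, a)) * cnj (vec_index w a) * vec_index v b)"
      using A v by (simp add: cip_mult_mat_vec_sum)
    also have "\<dots> = (\<Sum>b<m. \<Sum>a<m. A $$ (a, b) * vec_index v b * cnj (vec_index w a))"
    proof (intro sum.cong refl)
      fix a b assume "a \<in> {..<m}" "b \<in> {..<m}"
      then have "A $$ (a, b) = cnj (A $$ (b, a))"
        using h mat_adjoint_eq_iff[OF A] by blast
      then show "cnj (A $$ (b, a)) * cnj (vec_index w a) * vec_index v b =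
          A $$ (a, b) * vec_index v b * cnj (vec_index w a)"
        by (simp only: mult_ac)
    qed
    also have "\<dots> = (A *\<^sub>v v) \<bullet>c w"
      using A v by (simp add: cip_mult_mat_vec_sum) (rule sum.swap)
    finally show "(A *\<^sub>v v) \<bullet>c w = v \<bullet>c (A *\<^sub>v w)" by simp
  qed
next
  assume h: "\<forall>v\<in>carrier_vec m. \<forall>w\<in>carrier_vec m. (A *\<^sub>v v) \<bullet>c w = v \<bullet>c (A *\<^sub>v w)"
  have "A $$ (a, b) = cnj (A $$ (b, a))" if "a < m" "b < m" for a b
  proof -
    have "A $$ (a, b) = unit_vec m b \<bullet>c (A *\<^sub>v unit_vec m a)"
      using h A that mult_mat_unit_vec[OF A that] by (metis unit_vec_carrier)
    also have "\<dots> = cnj ((A *\<^sub>v unit_vec m a) \<bullet>c unit_vec m b)"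
      using A by (subst cip_cnj[of _ m]) auto
    finally show ?thesis using A that by (simp add: mult_mat_unit_vec)
  qed
  then show "mat_adjoint A = A" using mat_adjoint_eq_iff[OF A] by blast
qed

text \<open>Self-adjointness is used below only through the symmetry of the sesquilinear form.\<close>
lemma positive_definite_iff:
  assumes "A \<in> carrier_mat m m"
  shows "positive_definite A \<longleftrightarrow>
    (\<forall>v\<in>carrier_vec m. \<forall>w\<in>carrier_vec m. (A *\<^sub>v v) \<bullet>c w = v \<bullet>c (A *\<^sub>v w)) \<and>
    (\<forall>v\<in>carrier_vec m. v \<noteq> 0\<^sub>v m \<longrightarrow> 0 < Re ((A *\<^sub>v v) \<bullet>c v))"
  using assms by (simp add: positive_definite_def self_adjoint_iff)

lemma pd_sym:
  assumes "A \<in> carrier_mat m m" "positive_definite A" "v \<in> carrier_vec m" "w \<in> carrier_vec m"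
  shows "(A *\<^sub>v v) \<bullet>c w = v \<bullet>c (A *\<^sub>v w)"
  using assms positive_definite_iff[OF assms(1)] by blast

lemma pd_pos:
  assumes "A \<in> carrier_mat m m" "positive_definite A" "v \<in> carrier_vec m" "v \<noteq> 0\<^sub>v m"
  shows "0 < Re ((A *\<^sub>v v) \<bullet>c v)"
  using assms positive_definite_iff[OF assms(1)] by blast

lemma pd_nonneg:
  assumes "A \<in> carrier_mat m m" "positive_definite A" "v \<in> carrier_vec m"
  shows "0 \<le> Re ((A *\<^sub>v v) \<bullet>c v)"
proof (cases "v = 0\<^sub>v m")
  case True
  have "v \<bullet>c (A *\<^sub>v v) = 0" unfolding True using assms by (simp add: cip_sum[of _ m])
  then show ?thesis using assms by (simp add: pd_sym)
next
  case False then show ?thesis using pd_pos[OF assms] by simp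
qed

lemma pd_form_real:
  assumes "A \<in> carrier_mat m m" "positive_definite A" "v \<in> carrier_vec m"
  shows "(A *\<^sub>v v) \<bullet>c v = complex_of_real (Re ((A *\<^sub>v v) \<bullet>c v))"
proof -
  have "cnj ((A *\<^sub>v v) \<bullet>c v) = (A *\<^sub>v v) \<bullet>c v"
    using assms by (subst cip_cnj[of _ m]) (auto simp: pd_sym)
  then show ?thesis by (simp add: complex_eq_iff)
qed

text \<open>The Cauchy--Schwarz inequality for the inner product defined by \<open>A\<close>.\<close>
lemma pd_cauchy_schwarz:
  assumes A: "A \<in> carrier_mat m m" "positive_definite A" and v: "v \<in> carrier_vec m"
    and w: "w \<in> carrier_vec m"
  shows "(cmod ((A *\<^sub>v v) \<bullet>c w))\<^sup>2 \<le> Re ((A *\<^sub>v v) \<bullet>c v) * Re ((A *\<^sub>v w) \<bullet>c w)"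
proof (cases "w = 0\<^sub>v m")
  case True
  have "(A *\<^sub>v v) \<bullet>c w = 0" unfolding True using assms by (simp add: cip_sum[of _ m])
  then show ?thesis using pd_nonneg[OF A v] pd_nonneg[OF A w] by simp
next
  case False
  define a b s where "a = Re ((A *\<^sub>v v) \<bullet>c v)" and "b = Re ((A *\<^sub>v w) \<bullet>c w)" and "s = (A *\<^sub>v v) \<bullet>c w"
  have b: "0 < b" unfolding b_def using pd_pos[OF A w False] .
  have vv: "(A *\<^sub>v v) \<bullet>c v = of_real a" and ww: "(A *\<^sub>v w) \<bullet>c w = of_real b"
    unfolding a_def b_def using pd_form_real A v w by auto
  have wv: "(A *\<^sub>v w) \<bullet>c v = cnj s"
    unfolding s_def using A v w by (subst cip_cnj[of _ m]) (auto simp: pd_sym)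
  (* b times the component of v that is A-orthogonal to w *)
  define z where "z = of_real b \<cdot>\<^sub>v v - s \<cdot>\<^sub>v w"
  have z: "z \<in> carrier_vec m" unfolding z_def using v w by auto
  have Az: "A *\<^sub>v z = of_real b \<cdot>\<^sub>v (A *\<^sub>v v) - s \<cdot>\<^sub>v (A *\<^sub>v w)"
    unfolding z_def using A v w
    by (simp add: mult_minus_distrib_mat_vec[of _ m m] mult_mat_vec[of _ m m])
  have "(A *\<^sub>v z) \<bullet>c z = of_real b * (of_real b * of_real a - cnj s * s)"
    unfolding Az unfolding z_def using A v w
    by (simp add: cip_linear[of _ m] vv ww wv flip: s_def)
  also have "cnj s * s = of_real ((cmod s)\<^sup>2)"
    by (simp only: complex_norm_square mult.commute)
  also have "of_real b * (of_real b * of_real a - of_real ((cmod s)\<^sup>2)) = complex_of_real (b * (b * a - (cmod s)\<^sup>2))"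
    by simp
  finally have "0 \<le> b * (b * a - (cmod s)\<^sup>2)"
    using pd_nonneg[OF A z] by simp
  then show ?thesis using b unfolding a_def[symmetric] b_def[symmetric] s_def[symmetric]
    by (simp add: zero_le_mult_iff mult.commute)
qed

section \<open>Inverses of positive definite matrices\<close>

text \<open>The inverse of an invertible square matrix; an arbitrary matrix if there is no inverse.\<close>
definition minv :: "complex mat \<Rightarrow> complex mat" where
  "minv A = (SOME R. R \<in> carrier_mat (dim_row A) (dim_row A) \<and>
     A * R = 1\<^sub>m (dim_row A) \<and> R * A = 1\<^sub>m (dim_row A))"

lemma pd_minv:
  assumes A: "A \<in> carrier_mat m m" "positive_definite A"
  shows minv_carrier: "minv A \<in> carrier_mat m m"
    and mult_minv: "A * minv A = 1\<^sub>m m" and minv_mult: "minv A * A = 1\<^sub>m m"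
proof -
  have "det A \<noteq> 0"
  proof
    assume "det A = 0"
    then obtain v where v: "v \<in> carrier_vec m" "v \<noteq> 0\<^sub>v m" "A *\<^sub>v v = 0\<^sub>v m"
      using det_0_iff_vec_prod_zero[OF A(1)] by auto
    have "(A *\<^sub>v v) \<bullet>c v = 0" unfolding v(3) using v(1) by (simp add: cip_sum[of _ m])
    then show False using pd_pos[OF A v(1,2)] by simp
  qed
  then have "\<exists>R. R \<in> carrier_mat m m \<and> A * R = 1\<^sub>m m \<and> R * A = 1\<^sub>m m"
    using det_non_zero_imp_unit[OF A(1), of "()"] by (auto simp: Units_def ring_mat_def)
  from someI_ex[OF this] show "minv A \<in> carrier_mat m m" "A * minv A = 1\<^sub>m m" "minv A * A = 1\<^sub>m m"
    using A by (auto simp: minv_def)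
qed

lemma minv_vec:
  assumes A: "A \<in> carrier_mat m m" "positive_definite A" and v: "v \<in> carrier_vec m"
  shows "minv A *\<^sub>v v \<in> carrier_vec m"
    and "A *\<^sub>v (minv A *\<^sub>v v) = v" and "minv A *\<^sub>v (A *\<^sub>v v) = v"
proof -
  note R = pd_minv[OF A]
  show "minv A *\<^sub>v v \<in> carrier_vec m" using R v by auto
  have "A *\<^sub>v (minv A *\<^sub>v v) = (A * minv A) *\<^sub>v v" using A R(1) v by (simp add: assoc_mult_mat_vec)
  then show "A *\<^sub>v (minv A *\<^sub>v v) = v" using R v by simp
  have "minv A *\<^sub>v (A *\<^sub>v v) = (minv A * A) *\<^sub>v v" using A R(1) v by (simp add: assoc_mult_mat_vec)
  then show "minv A *\<^sub>v (A *\<^sub>v v) = v" using R v by simp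
qed

lemma minv_unique:
  assumes A: "A \<in> carrier_mat m m" "positive_definite A"
    and v: "v \<in> carrier_vec m" "w \<in> carrier_vec m" "A *\<^sub>v w = v"
  shows "minv A *\<^sub>v v = w"
  using minv_vec(3)[OF A v(2)] v by simp

lemma minv_positive_definite:
  assumes A: "A \<in> carrier_mat m m" "positive_definite A"
  shows "positive_definite (minv A)"
  unfolding positive_definite_iff[OF minv_carrier[OF A]]
proof (intro conjI ballI impI)
  fix v w :: "complex vec" assume v: "v \<in> carrier_vec m" and w: "w \<in> carrier_vec m"
  show "(minv A *\<^sub>v v) \<bullet>c w = v \<bullet>c (minv A *\<^sub>v w)"
    using pd_sym[OF A minv_vec(1)[OF A v] minv_vec(1)[OF A w]] minv_vec(2)[OF A] v w by simp
next
  fix v :: "complex vec" assume v: "v \<in> carrier_vec m" and nz: "v \<noteq> 0\<^sub>v m"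
  have "minv A *\<^sub>v v \<noteq> 0\<^sub>v m"
  proof
    assume "minv A *\<^sub>v v = 0\<^sub>v m"
    then have "v = A *\<^sub>v 0\<^sub>v m" using minv_vec(2)[OF A v] by simp
    then show False using nz A by (auto simp: vec_eq_iff scalar_prod_def)
  qed
  from pd_pos[OF A minv_vec(1)[OF A v] this]
  have "0 < Re (v \<bullet>c (minv A *\<^sub>v v))" using minv_vec(2)[OF A v] by simp
  also have "v \<bullet>c (minv A *\<^sub>v v) = cnj ((minv A *\<^sub>v v) \<bullet>c v)"
    using minv_vec(1)[OF A v] v by (subst cip_cnj[of _ m]) auto
  finally show "0 < Re ((minv A *\<^sub>v v) \<bullet>c v)" by simp
qed

text \<open>The (real) trace of the inverse; on \<open>u I - M\<close> and \<open>M - l I\<close> it is the barrier potential.\<close>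
definition trace_inv :: "complex mat \<Rightarrow> real" where
  "trace_inv A = (\<Sum>j<dim_row A. Re ((minv A *\<^sub>v unit_vec (dim_row A) j) \<bullet>c unit_vec (dim_row A) j))"

lemma trace_inv_eq:
  assumes "A \<in> carrier_mat m m"
  shows "trace_inv A = (\<Sum>j<m. Re ((minv A *\<^sub>v unit_vec m j) \<bullet>c unit_vec m j))"
  using assms by (simp add: trace_inv_def)

lemma cip_commute:
  fixes v w :: "complex vec"
  assumes "v \<in> carrier_vec m" "w \<in> carrier_vec m"
  shows "v \<bullet>c w = cnj (w \<bullet>c v)"
  using assms by (simp add: cip_cnj)

section \<open>Resolvents of a matrix and of its shift\<close>

text \<open>Here and below \<open>Bs\<close> and \<open>Bb\<close> (the smaller and the bigger matrix) differ by a multiple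
  \<open>d\<close> of the identity. Such relations between matrices are expressed by their action on
  vectors. The two equations are \<open>Bs\<^sup>-\<^sup>1 - Bb\<^sup>-\<^sup>1 = d Bs\<^sup>-\<^sup>1 Bb\<^sup>-\<^sup>1 = d Bb\<^sup>-\<^sup>1 Bs\<^sup>-\<^sup>1\<close>.\<close>
lemma resolvent_identity:
  assumes Bs: "Bs \<in> carrier_mat m m" "positive_definite Bs"
    and Bb: "Bb \<in> carrier_mat m m" "positive_definite Bb"
    and shift: "\<And>v. v \<in> carrier_vec m \<Longrightarrow> Bb *\<^sub>v v = Bs *\<^sub>v v + complex_of_real d \<cdot>\<^sub>v v"
    and v: "v \<in> carrier_vec m"
  shows "minv Bs *\<^sub>v v = minv Bb *\<^sub>v v + complex_of_real d \<cdot>\<^sub>v (minv Bs *\<^sub>v (minv Bb *\<^sub>v v))"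
    and "minv Bs *\<^sub>v v = minv Bb *\<^sub>v v + complex_of_real d \<cdot>\<^sub>v (minv Bb *\<^sub>v (minv Bs *\<^sub>v v))"
proof -
  define y where "y = minv Bb *\<^sub>v v"
  have y: "y \<in> carrier_vec m" "Bb *\<^sub>v y = v" using minv_vec[OF Bb v] by (auto simp: y_def)
  note Ry = minv_vec[OF Bs y(1)]
  have "Bs *\<^sub>v (y + complex_of_real d \<cdot>\<^sub>v (minv Bs *\<^sub>v y)) = Bb *\<^sub>v y"
    using Bs y(1) Ry shift[OF y(1)]
    by (simp add: mult_add_distrib_mat_vec[of _ m m] mult_mat_vec[of _ m m])
  then show "minv Bs *\<^sub>v v = minv Bb *\<^sub>v v + complex_of_real d \<cdot>\<^sub>v (minv Bs *\<^sub>v (minv Bb *\<^sub>v v))"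
    unfolding y_def[symmetric] using y Ry by (intro minv_unique[OF Bs v]) auto
  define z where "z = minv Bs *\<^sub>v v"
  have z: "z \<in> carrier_vec m" "Bs *\<^sub>v z = v" using minv_vec[OF Bs v] by (auto simp: z_def)
  have "z = minv Bb *\<^sub>v (Bb *\<^sub>v z)" using minv_vec(3)[OF Bb z(1)] by simp
  also have "\<dots> = minv Bb *\<^sub>v (v + complex_of_real d \<cdot>\<^sub>v z)" using shift[OF z(1)] z by simp
  also have "\<dots> = minv Bb *\<^sub>v v + complex_of_real d \<cdot>\<^sub>v (minv Bb *\<^sub>v z)"
    using minv_carrier[OF Bb] v z
    by (simp add: mult_add_distrib_mat_vec[of _ m m] mult_mat_vec[of _ m m])
  finally show "minv Bs *\<^sub>v v = minv Bb *\<^sub>v v + complex_of_real d \<cdot>\<^sub>v (minv Bb *\<^sub>v (minv Bs *\<^sub>v v))"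
    unfolding z_def .
qed

text \<open>The squared Frobenius norm of the inverse, which is \<open>tr A\<^sup>-\<^sup>2\<close> for positive definite \<open>A\<close>.\<close>
definition inv_frob :: "complex mat \<Rightarrow> real" where
  "inv_frob A = (\<Sum>j<dim_row A. sq_norm (minv A *\<^sub>v unit_vec (dim_row A) j))"

lemma inv_frob_pos:
  assumes B: "B \<in> carrier_mat m m" "positive_definite B" and m: "0 < m"
  shows "0 < inv_frob B"
proof -
  have "minv B *\<^sub>v unit_vec m 0 \<noteq> 0\<^sub>v m"
  proof
    assume "minv B *\<^sub>v unit_vec m 0 = 0\<^sub>v m"
    then have "B *\<^sub>v 0\<^sub>v m = unit_vec m 0" using minv_vec(2)[OF B, of "unit_vec m 0"] by simp
    then have "unit_vec m 0 = (0\<^sub>v m :: complex vec)" using B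
      by (auto simp: vec_eq_iff scalar_prod_def)
    then show False using m by simp
  qed
  then have "0 < sq_norm (minv B *\<^sub>v unit_vec m 0)"
    using minv_vec(1)[OF B] by (intro sq_norm_pos[of _ m]) auto
  then show ?thesis using B m unfolding inv_frob_def
    by (intro sum_pos2[of _ 0]) (auto simp: sq_norm_nonneg)
qed

text \<open>With \<open>S = Bs\<^sup>-\<^sup>1\<close> and \<open>R = Bb\<^sup>-\<^sup>1\<close> the numbers are \<open>T = tr (S R)\<close>, \<open>X = tr (R S R)\<close> and
  \<open>Y = tr (S R S)\<close>. The equations follow from the resolvent identity; the last inequality is
  the Cauchy--Schwarz inequality for the form \<open>(A, B) \<mapsto> tr (B\<^sup>* R A)\<close>, applied to
  \<open>S\<close> and the identity.\<close>
lemma resolvent_traces: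
  assumes Bs: "Bs \<in> carrier_mat m m" "positive_definite Bs"
    and Bb: "Bb \<in> carrier_mat m m" "positive_definite Bb"
    and shift: "\<And>v. v \<in> carrier_vec m \<Longrightarrow> Bb *\<^sub>v v = Bs *\<^sub>v v + complex_of_real d \<cdot>\<^sub>v v"
  obtains T X Y where "trace_inv Bs - trace_inv Bb = d * T"
    and "T = inv_frob Bb + d * X" and "0 \<le> X"
    and "inv_frob Bs = T + d * Y" and "0 \<le> Y" and "T\<^sup>2 \<le> trace_inv Bb * Y"
proof -
  define e where "e = (unit_vec m :: nat \<Rightarrow> complex vec)"
  have e: "e j \<in> carrier_vec m" for j by (simp add: e_def)
  define Rs Rb where "Rs = (\<lambda>v. minv Bs *\<^sub>v v)" and "Rb = (\<lambda>v. minv Bb *\<^sub>v v)"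
  have c: "Rs v \<in> carrier_vec m" "Rb v \<in> carrier_vec m" if "v \<in> carrier_vec m" for v
    using that minv_vec(1)[OF Bs] minv_vec(1)[OF Bb] by (auto simp: Rs_def Rb_def)
  note cc = c e
  have sym: "Rs v \<bullet>c w = v \<bullet>c Rs w" "Rb v \<bullet>c w = v \<bullet>c Rb w"
    if "v \<in> carrier_vec m" "w \<in> carrier_vec m" for v w
    using that pd_sym[OF minv_carrier[OF Bs] minv_positive_definite[OF Bs]]
      pd_sym[OF minv_carrier[OF Bb] minv_positive_definite[OF Bb]] by (auto simp: Rs_def Rb_def)
  have id1: "Rs v = Rb v + complex_of_real d \<cdot>\<^sub>v Rs (Rb v)"
    and id2: "Rs v = Rb v + complex_of_real d \<cdot>\<^sub>v Rb (Rs v)" if "v \<in> carrier_vec m" for v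
    using resolvent_identity[OF Bs Bb shift that] by (auto simp: Rs_def Rb_def)
  define T where "T = (\<Sum>j<m. Re (Rs (Rb (e j)) \<bullet>c e j))"
  define X where "X = (\<Sum>j<m. Re (Rs (Rb (e j)) \<bullet>c Rb (e j)))"
  define Y where "Y = (\<Sum>j<m. Re (Rb (Rs (e j)) \<bullet>c Rs (e j)))"
  have T': "T = (\<Sum>j<m. Re (Rb (Rs (e j)) \<bullet>c e j))"
    unfolding T_def
  proof (intro sum.cong refl)
    fix j
    have "Rs (Rb (e j)) \<bullet>c e j = Rb (e j) \<bullet>c Rs (e j)" by (rule sym) (auto intro: cc)
    also have "\<dots> = cnj (Rs (e j) \<bullet>c Rb (e j))" by (rule cip_commute) (auto intro: cc)
    also have "Rs (e j) \<bullet>c Rb (e j) = Rb (Rs (e j)) \<bullet>c e j"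
      by (rule sym(2)[symmetric]) (auto intro: cc)
    finally show "Re (Rs (Rb (e j)) \<bullet>c e j) = Re (Rb (Rs (e j)) \<bullet>c e j)" by simp
  qed
  have tr: "trace_inv Bs = (\<Sum>j<m. Re (Rs (e j) \<bullet>c e j))" "trace_inv Bb = (\<Sum>j<m. Re (Rb (e j) \<bullet>c e j))"
    using Bs Bb by (auto simp: trace_inv_eq Rs_def Rb_def e_def)
  have fr: "inv_frob Bs = (\<Sum>j<m. sq_norm (Rs (e j)))" "inv_frob Bb = (\<Sum>j<m. sq_norm (Rb (e j)))"
    using Bs Bb by (auto simp: inv_frob_def Rs_def Rb_def e_def)
  show thesis
  proof (rule that)
    have "Re (Rs (e j) \<bullet>c e j) = Re (Rb (e j) \<bullet>c e j) + d * Re (Rs (Rb (e j)) \<bullet>c e j)" for j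
      by (subst id1[OF e]) (simp add: cip_linear[of _ m] cc)
    then show "trace_inv Bs - trace_inv Bb = d * T"
      unfolding tr T_def by (simp add: sum.distrib sum_distrib_left)
  next
    have "Re (Rs (Rb (e j)) \<bullet>c e j) = sq_norm (Rb (e j)) + d * Re (Rs (Rb (e j)) \<bullet>c Rb (e j))" for j
    proof -
      have "Rs (Rb (e j)) \<bullet>c e j = Rb (Rb (e j)) \<bullet>c e j + of_real d * (Rb (Rs (Rb (e j))) \<bullet>c e j)"
        by (subst id2) (auto simp: cip_linear[of _ m] cc)
      also have "Rb (Rb (e j)) \<bullet>c e j = Rb (e j) \<bullet>c Rb (e j)" by (rule sym) (auto intro: cc)
      also have "Rb (Rs (Rb (e j))) \<bullet>c e j = Rs (Rb (e j)) \<bullet>c Rb (e j)"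
        by (rule sym) (auto intro: cc)
      finally show ?thesis by (simp add: cip_self)
    qed
    then show "T = inv_frob Bb + d * X"
      unfolding fr T_def X_def by (simp add: sum.distrib sum_distrib_left)
  next
    show "0 \<le> X" unfolding X_def Rs_def
      by (intro sum_nonneg pd_nonneg[OF minv_carrier[OF Bs] minv_positive_definite[OF Bs]] cc)
  next
    have "sq_norm (Rs (e j)) = Re (Rb (Rs (e j)) \<bullet>c e j) + d * Re (Rb (Rs (e j)) \<bullet>c Rs (e j))" for j
    proof -
      have "complex_of_real (sq_norm (Rs (e j))) = Rs (Rs (e j)) \<bullet>c e j"
        by (subst sym) (auto simp: cc cip_self)
      also have "\<dots> = Rb (Rs (e j)) \<bullet>c e j + of_real d * (Rs (Rb (Rs (e j))) \<bullet>c e j)"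
        by (subst id1) (auto simp: cip_linear[of _ m] cc)
      also have "Rs (Rb (Rs (e j))) \<bullet>c e j = Rb (Rs (e j)) \<bullet>c Rs (e j)"
        by (rule sym) (auto intro: cc)
      finally show ?thesis by (simp add: complex_eq_iff)
    qed
    then show "inv_frob Bs = T + d * Y"
      unfolding fr T' Y_def by (simp add: sum.distrib sum_distrib_left)
  next
    show "0 \<le> Y" unfolding Y_def Rb_def
      by (intro sum_nonneg pd_nonneg[OF minv_carrier[OF Bb] minv_positive_definite[OF Bb]] cc)
  next
    define a b where "a j = Re (Rb (Rs (e j)) \<bullet>c Rs (e j))" and "b j = Re (Rb (e j) \<bullet>c e j)" for j
    have ab: "0 \<le> a j" "0 \<le> b j" for j
      unfolding a_def b_def Rb_def
      by (intro pd_nonneg[OF minv_carrier[OF Bb] minv_positive_definite[OF Bb]] cc)+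
    have "\<bar>Re (Rb (Rs (e j)) \<bullet>c e j)\<bar> \<le> sqrt (b j) * sqrt (a j)" for j
    proof -
      have "\<bar>Re (Rb (Rs (e j)) \<bullet>c e j)\<bar> \<le> cmod (Rb (Rs (e j)) \<bullet>c e j)" by (rule abs_Re_le_cmod)
      also have "\<dots> \<le> sqrt (a j * b j)"
        unfolding a_def b_def Rb_def
        by (intro real_le_rsqrt pd_cauchy_schwarz[OF minv_carrier[OF Bb] minv_positive_definite[OF Bb]] cc)
      finally show ?thesis by (simp add: real_sqrt_mult mult.commute)
    qed
    then have "\<bar>T\<bar> \<le> (\<Sum>j<m. sqrt (b j) * sqrt (a j))"
      unfolding T' by (intro order.trans[OF sum_abs] sum_mono)
    then have "T\<^sup>2 \<le> (\<Sum>j<m. sqrt (b j) * sqrt (a j))\<^sup>2"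
      by (simp add: abs_le_square_iff[symmetric])
    also have "\<dots> \<le> (\<Sum>j<m. (sqrt (b j))\<^sup>2) * (\<Sum>j<m. (sqrt (a j))\<^sup>2)"
      by (rule Cauchy_Schwarz_ineq_sum)
    also have "\<dots> = trace_inv Bb * Y" unfolding tr Y_def using ab by (simp add: a_def b_def)
    finally show "T\<^sup>2 \<le> trace_inv Bb * Y" .
  qed
qed

lemma trace_inv_mono:
  assumes Bs: "Bs \<in> carrier_mat m m" "positive_definite Bs"
    and Bb: "Bb \<in> carrier_mat m m" "positive_definite Bb"
    and shift: "\<And>v. v \<in> carrier_vec m \<Longrightarrow> Bb *\<^sub>v v = Bs *\<^sub>v v + complex_of_real d \<cdot>\<^sub>v v"
    and "0 < m" "0 < d"
  shows "trace_inv Bb < trace_inv Bs"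
proof -
  obtain T X Y where r: "trace_inv Bs - trace_inv Bb = d * T" "T = inv_frob Bb + d * X" "0 \<le> X"
    using resolvent_traces[OF Bs Bb shift] by metis
  have "0 < T" using r inv_frob_pos[OF Bb \<open>0 < m\<close>] \<open>0 < d\<close> by (simp add: add_pos_nonneg)
  then have "0 < d * T" using \<open>0 < d\<close> by simp
  then show ?thesis using r(1) by linarith
qed

text \<open>The left-hand side is the integral, over an isotropic family, of the quadratic form in
  the bound of \<open>upper_barrier_step\<close> below.\<close>
lemma upper_average:
  assumes Bs: "Bs \<in> carrier_mat m m" "positive_definite Bs"
    and Bb: "Bb \<in> carrier_mat m m" "positive_definite Bb"
    and shift: "\<And>v. v \<in> carrier_vec m \<Longrightarrow> Bb *\<^sub>v v = Bs *\<^sub>v v + complex_of_real d \<cdot>\<^sub>v v"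
    and m: "0 < m" and d: "0 < d"
  shows "inv_frob Bb / (trace_inv Bs - trace_inv Bb) + trace_inv Bb \<le> 1 / d + trace_inv Bs"
proof -
  obtain T X Y where r: "trace_inv Bs - trace_inv Bb = d * T" "T = inv_frob Bb + d * X" "0 \<le> X"
    using resolvent_traces[OF Bs Bb shift] by metis
  have N: "0 < inv_frob Bb" "inv_frob Bb \<le> T"
    using r inv_frob_pos[OF Bb m] d by auto
  then have "inv_frob Bb / (d * T) \<le> 1 / d"
    using d by (simp add: divide_simps)
  then show ?thesis using r(1) trace_inv_mono[OF Bs Bb shift m d] by simp
qed

text \<open>The counterpart for \<open>lower_barrier_step\<close>, where the right-hand side is the integral.
  The potential has to be small because the Cauchy--Schwarz bound of \<open>resolvent_traces\<close>
  contains it as a factor.\<close>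
lemma lower_average:
  assumes Bs: "Bs \<in> carrier_mat m m" "positive_definite Bs"
    and Bb: "Bb \<in> carrier_mat m m" "positive_definite Bb"
    and shift: "\<And>v. v \<in> carrier_vec m \<Longrightarrow> Bb *\<^sub>v v = Bs *\<^sub>v v + complex_of_real d \<cdot>\<^sub>v v"
    and m: "0 < m" and d: "0 < d" and small: "d * trace_inv Bb \<le> 1"
  shows "1 / d - trace_inv Bb \<le> inv_frob Bs / (trace_inv Bs - trace_inv Bb) - trace_inv Bs"
proof -
  obtain T X Y where r: "trace_inv Bs - trace_inv Bb = d * T" "T = inv_frob Bb + d * X" "0 \<le> X"
    "inv_frob Bs = T + d * Y" "0 \<le> Y" "T\<^sup>2 \<le> trace_inv Bb * Y"
    using resolvent_traces[OF Bs Bb shift] by metis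
  have T: "0 < T" using r inv_frob_pos[OF Bb m] d by (simp add: add_pos_nonneg)
  have "d * T\<^sup>2 \<le> d * (trace_inv Bb * Y)" using r(6) d by simp
  also have "\<dots> = (d * trace_inv Bb) * Y" by simp
  also have "\<dots> \<le> 1 * Y" using small r(5) by (intro mult_right_mono)
  finally have "d * (d * T\<^sup>2) \<le> d * Y" using d by simp
  then have "(T + d * (d * T\<^sup>2)) / (d * T) \<le> inv_frob Bs / (d * T)"
    using d T r(4) by (intro divide_right_mono) auto
  moreover have "(T + d * (d * T\<^sup>2)) / (d * T) = 1 / d + d * T"
    using d T by (simp add: field_simps power2_eq_square)
  ultimately show ?thesis unfolding r(1) using r(1) by linarith
qed

text \<open>The smallest eigenvalue of \<open>B\<close> is at least \<open>1 / tr B\<^sup>-\<^sup>1\<close>; in particular a lower barrier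
  with potential less than \<open>1/d\<close> can be raised by \<open>d\<close>.\<close>
lemma sq_norm_le_trace_inv:
  assumes B: "B \<in> carrier_mat m m" "positive_definite B" and v: "v \<in> carrier_vec m"
  shows "sq_norm v \<le> trace_inv B * Re ((B *\<^sub>v v) \<bullet>c v)"
proof -
  define w where "w = B *\<^sub>v v"
  have w: "w \<in> carrier_vec m" "minv B *\<^sub>v w = v"
    using minv_vec[OF B v] B v by (auto simp: w_def)
  have "sq_norm v = (\<Sum>j<m. (cmod ((minv B *\<^sub>v w) \<bullet>c unit_vec m j))\<^sup>2)"
    using w v by (simp add: sum_cip_unit_vec)
  also have "\<dots> \<le> (\<Sum>j<m. Re ((minv B *\<^sub>v w) \<bullet>c w) * Re ((minv B *\<^sub>v unit_vec m j) \<bullet>c unit_vec m j))"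
    by (intro sum_mono pd_cauchy_schwarz[OF minv_carrier[OF B] minv_positive_definite[OF B] w(1)]) simp
  also have "\<dots> = Re (v \<bullet>c w) * trace_inv B"
    using B w by (simp add: trace_inv_eq sum_distrib_left)
  also have "v \<bullet>c w = w \<bullet>c v"
    unfolding w_def using pd_sym[OF B v v] by simp
  finally show ?thesis by (simp add: w_def mult.commute)
qed

lemma pd_shift_down:
  assumes Bb: "Bb \<in> carrier_mat m m" "positive_definite Bb" and Bs: "Bs \<in> carrier_mat m m"
    and shift: "\<And>v. v \<in> carrier_vec m \<Longrightarrow> Bb *\<^sub>v v = Bs *\<^sub>v v + complex_of_real d \<cdot>\<^sub>v v"
    and d: "0 < d" and small: "d * trace_inv Bb < 1"
  shows "positive_definite Bs"
  unfolding positive_definite_iff[OF Bs]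
proof (intro conjI ballI impI)
  fix v w :: "complex vec" assume v: "v \<in> carrier_vec m" and w: "w \<in> carrier_vec m"
  have "(Bs *\<^sub>v v) \<bullet>c w + of_real d * (v \<bullet>c w) = (Bb *\<^sub>v v) \<bullet>c w"
    using v w Bs by (simp add: shift cip_linear[of _ m])
  also have "\<dots> = v \<bullet>c (Bb *\<^sub>v w)" by (rule pd_sym[OF Bb v w])
  also have "\<dots> = v \<bullet>c (Bs *\<^sub>v w) + of_real d * (v \<bullet>c w)"
    using v w Bs by (simp add: shift cip_linear[of _ m])
  finally show "(Bs *\<^sub>v v) \<bullet>c w = v \<bullet>c (Bs *\<^sub>v w)" by simp
next
  fix v :: "complex vec" assume v: "v \<in> carrier_vec m" "v \<noteq> 0\<^sub>v m"
  define q where "q = Re ((Bb *\<^sub>v v) \<bullet>c v)"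
  have q: "0 < q" unfolding q_def by (rule pd_pos[OF Bb v])
  have "d * sq_norm v \<le> d * (trace_inv Bb * q)"
    unfolding q_def using d sq_norm_le_trace_inv[OF Bb v(1)] by simp
  also have "\<dots> = (d * trace_inv Bb) * q" by simp
  also have "\<dots> < 1 * q" using q small by (intro mult_strict_right_mono)
  finally have "d * sq_norm v < q" by simp
  moreover have "q = Re ((Bs *\<^sub>v v) \<bullet>c v) + d * sq_norm v"
    unfolding q_def using v Bs by (simp add: shift cip_linear[of _ m] cip_self)
  ultimately show "0 < Re ((Bs *\<^sub>v v) \<bullet>c v)" by simp
qed

section \<open>Rank-one updates\<close>

text \<open>The hypothesis on \<open>C\<close> says that \<open>C = B + c v v\<^sup>*\<close>.\<close>
lemma rank_one_update_form:
  assumes B: "B \<in> carrier_mat m m" and C: "C \<in> carrier_mat m m" and v: "v \<in> carrier_vec m"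
    and upd: "\<And>y. y \<in> carrier_vec m \<Longrightarrow> C *\<^sub>v y = B *\<^sub>v y + (complex_of_real c * (y \<bullet>c v)) \<cdot>\<^sub>v v"
    and y: "y \<in> carrier_vec m" and w: "w \<in> carrier_vec m"
  shows "(C *\<^sub>v y) \<bullet>c w = (B *\<^sub>v y) \<bullet>c w + of_real c * (y \<bullet>c v) * (v \<bullet>c w)"
    and "y \<bullet>c (C *\<^sub>v w) = y \<bullet>c (B *\<^sub>v w) + of_real c * (y \<bullet>c v) * (v \<bullet>c w)"
  using B v y w cip_cnj[OF w v] by (auto simp: upd cip_linear[of _ m])

lemma pd_rank_one_update:
  assumes B: "B \<in> carrier_mat m m" "positive_definite B" and C: "C \<in> carrier_mat m m"
    and v: "v \<in> carrier_vec m"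
    and upd: "\<And>y. y \<in> carrier_vec m \<Longrightarrow> C *\<^sub>v y = B *\<^sub>v y + (complex_of_real c * (y \<bullet>c v)) \<cdot>\<^sub>v v"
    and c: "0 < 1 + c * Re ((minv B *\<^sub>v v) \<bullet>c v)"
  shows "positive_definite C"
  unfolding positive_definite_iff[OF C]
proof (intro conjI ballI impI)
  fix y w :: "complex vec" assume y: "y \<in> carrier_vec m" and w: "w \<in> carrier_vec m"
  show "(C *\<^sub>v y) \<bullet>c w = y \<bullet>c (C *\<^sub>v w)"
    using rank_one_update_form[OF B(1) C v upd y w] pd_sym[OF B y w] by simp
next
  fix w :: "complex vec" assume w: "w \<in> carrier_vec m" "w \<noteq> 0\<^sub>v m"
  define q a s where "q = Re ((B *\<^sub>v w) \<bullet>c w)" and "a = Re ((minv B *\<^sub>v v) \<bullet>c v)" and "s = (cmod (w \<bullet>c v))\<^sup>2"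
  have q: "0 < q" unfolding q_def by (rule pd_pos[OF B w])
  have Bw: "B *\<^sub>v w \<in> carrier_vec m" using B w by simp
  have "s \<le> Re ((minv B *\<^sub>v (B *\<^sub>v w)) \<bullet>c (B *\<^sub>v w)) * a"
    unfolding s_def a_def
    using pd_cauchy_schwarz[OF minv_carrier[OF B] minv_positive_definite[OF B] Bw v] minv_vec(3)[OF B w(1)] by simp
  also have "(minv B *\<^sub>v (B *\<^sub>v w)) \<bullet>c (B *\<^sub>v w) = (B *\<^sub>v w) \<bullet>c w"
    using minv_vec(3)[OF B w(1)] pd_sym[OF B w(1) w(1)] by simp
  finally have s: "s \<le> q * a" by (simp add: q_def)
  have "(w \<bullet>c v) * (v \<bullet>c w) = of_real s"
    unfolding s_def complex_norm_square using cip_cnj[OF w(1) v] by simp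
  then have "(C *\<^sub>v w) \<bullet>c w = (B *\<^sub>v w) \<bullet>c w + of_real (c * s)"
    using rank_one_update_form(1)[OF B(1) C v upd w(1) w(1)] by (simp add: mult.assoc)
  then have C': "Re ((C *\<^sub>v w) \<bullet>c w) = q + c * s" by (simp add: q_def)
  have "0 < q + c * s"
  proof (cases "0 \<le> c")
    case True then show ?thesis using q by (simp add: s_def add_pos_nonneg)
  next
    case False
    have "0 < q * (1 + c * a)" using q c by (simp add: a_def)
    also have "\<dots> = q + c * (q * a)" by (simp add: algebra_simps)
    also have "\<dots> \<le> q + c * s" using s False by (simp add: mult_left_mono_neg)
    finally show ?thesis .
  qed
  then show "0 < Re ((C *\<^sub>v w) \<bullet>c w)" using C' by simp
qed

text \<open>The trace of the Sherman--Morrison formula. On each vector the formula is verified by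
  solving \<open>C y = w\<close> for \<open>y\<close>.\<close>
lemma trace_inv_rank_one_update:
  assumes B: "B \<in> carrier_mat m m" "positive_definite B" and C: "C \<in> carrier_mat m m"
    and v: "v \<in> carrier_vec m"
    and upd: "\<And>y. y \<in> carrier_vec m \<Longrightarrow> C *\<^sub>v y = B *\<^sub>v y + (complex_of_real c * (y \<bullet>c v)) \<cdot>\<^sub>v v"
    and c: "0 < 1 + c * Re ((minv B *\<^sub>v v) \<bullet>c v)"
  shows "trace_inv C = trace_inv B - c * sq_norm (minv B *\<^sub>v v) / (1 + c * Re ((minv B *\<^sub>v v) \<bullet>c v))"
proof -
  have Cpd: "positive_definite C" by (rule pd_rank_one_update[OF B C v upd c])
  define a where "a = Re ((minv B *\<^sub>v v) \<bullet>c v)"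
  define Rv where "Rv = minv B *\<^sub>v v"
  have Rv: "Rv \<in> carrier_vec m" unfolding Rv_def by (rule minv_vec(1)[OF B v])
  note R = minv_carrier[OF B] minv_positive_definite[OF B]
  have a: "Rv \<bullet>c v = of_real a" unfolding a_def Rv_def by (rule pd_form_real[OF R v])
  have k: "0 < 1 + c * a" using c by (simp add: a_def)
  have "Re ((minv C *\<^sub>v w) \<bullet>c w) = Re ((minv B *\<^sub>v w) \<bullet>c w) - c / (1 + c * a) * (cmod (Rv \<bullet>c w))\<^sup>2"
    if w: "w \<in> carrier_vec m" for w
  proof -
    define y where "y = minv C *\<^sub>v w"
    have y: "y \<in> carrier_vec m" "C *\<^sub>v y = w" unfolding y_def using minv_vec[OF C Cpd w] by auto
    define b where "b = of_real c * (y \<bullet>c v)"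
    have Rw: "minv B *\<^sub>v w \<in> carrier_vec m" by (rule minv_vec(1)[OF B w])
    have "minv B *\<^sub>v w = minv B *\<^sub>v (B *\<^sub>v y + b \<cdot>\<^sub>v v)"
      using upd[OF y(1)] y(2) by (simp add: b_def)
    also have "\<dots> = y + b \<cdot>\<^sub>v Rv"
      using R(1) B(1) y v minv_vec(3)[OF B y(1)]
      by (simp add: mult_add_distrib_mat_vec[of _ m m] mult_mat_vec[of _ m m] Rv_def)
    finally have Rwy: "minv B *\<^sub>v w = y + b \<cdot>\<^sub>v Rv" .
    have yv: "(minv B *\<^sub>v w) \<bullet>c v = (y \<bullet>c v) * of_real (1 + c * a)"
      unfolding Rwy using y Rv v by (simp add: cip_linear[of _ m] a b_def algebra_simps)
    have vw: "(minv B *\<^sub>v w) \<bullet>c v = cnj (Rv \<bullet>c w)"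
      using pd_sym[OF R w v] cip_cnj[OF Rv w] by (simp add: Rv_def)
    have k': "complex_of_real (1 + c * a) \<noteq> 0" using k by (simp only: of_real_eq_0_iff)
    have "y \<bullet>c v = cnj (Rv \<bullet>c w) / of_real (1 + c * a)"
      using yv unfolding vw nonzero_eq_divide_eq[OF k'] by (rule sym)
    then have "b * (Rv \<bullet>c w) = of_real c / of_real (1 + c * a) * ((Rv \<bullet>c w) * cnj (Rv \<bullet>c w))"
      unfolding b_def by simp
    also have "\<dots> = of_real (c / (1 + c * a) * (cmod (Rv \<bullet>c w))\<^sup>2)"
      by (simp only: complex_norm_square[symmetric] of_real_mult of_real_divide)
    finally have "(minv B *\<^sub>v w) \<bullet>c w = y \<bullet>c w + of_real (c / (1 + c * a) * (cmod (Rv \<bullet>c w))\<^sup>2)"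
      unfolding Rwy using y Rv w by (simp add: cip_linear[of _ m])
    then show ?thesis by (simp add: y_def)
  qed
  then have "trace_inv C = (\<Sum>j<m. Re ((minv B *\<^sub>v unit_vec m j) \<bullet>c unit_vec m j)
      - c / (1 + c * a) * (cmod (Rv \<bullet>c unit_vec m j))\<^sup>2)"
    using C by (simp add: trace_inv_eq)
  also have "\<dots> = trace_inv B - c / (1 + c * a) * sq_norm Rv"
    unfolding sum_subtractf sum_distrib_left[symmetric] sum_cip_unit_vec[OF Rv] trace_inv_eq[OF B(1)] ..
  finally show ?thesis by (simp add: a_def Rv_def)
qed

text \<open>Here \<open>Bs = u I - M\<close>, and \<open>Bb\<close> is the same matrix for the raised barrier; adding
  \<open>t v v\<^sup>*\<close> to \<open>M\<close> brings the potential back to at most its old value.\<close>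
lemma upper_barrier_step:
  assumes Bs: "Bs \<in> carrier_mat m m" "positive_definite Bs"
    and Bb: "Bb \<in> carrier_mat m m" "positive_definite Bb"
    and gap: "trace_inv Bb < trace_inv Bs"
    and C: "C \<in> carrier_mat m m" and v: "v \<in> carrier_vec m" "v \<noteq> 0\<^sub>v m" and t: "0 < t"
    and upd: "\<And>y. y \<in> carrier_vec m \<Longrightarrow> C *\<^sub>v y = Bb *\<^sub>v y - (complex_of_real t * (y \<bullet>c v)) \<cdot>\<^sub>v v"
    and bound: "sq_norm (minv Bb *\<^sub>v v) / (trace_inv Bs - trace_inv Bb) + Re ((minv Bb *\<^sub>v v) \<bullet>c v) \<le> 1 / t"
  shows "positive_definite C" and "trace_inv C \<le> trace_inv Bs"
proof -
  define N a D where "N = sq_norm (minv Bb *\<^sub>v v)" and "a = Re ((minv Bb *\<^sub>v v) \<bullet>c v)"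
    and "D = trace_inv Bs - trace_inv Bb"
  have D: "0 < D" using gap by (simp add: D_def)
  have "minv Bb *\<^sub>v v \<noteq> 0\<^sub>v m"
  proof
    assume z: "minv Bb *\<^sub>v v = 0\<^sub>v m"
    have "0 < Re ((minv Bb *\<^sub>v v) \<bullet>c v)"
      by (rule pd_pos[OF minv_carrier[OF Bb] minv_positive_definite[OF Bb] v])
    then show False unfolding z using v by (simp add: cip_sum[of _ m])
  qed
  then have N: "0 < N" unfolding N_def by (rule sq_norm_pos[OF minv_vec(1)[OF Bb v(1)]])
  have b: "N / D + a \<le> 1 / t" using bound by (simp add: N_def a_def D_def)
  have "0 < N / D" using N D by simp
  then have "a < 1 / t" using b by linarith
  then have ta: "0 < 1 + (-t) * a" using t by (simp add: field_simps)
  have "N / D \<le> (1 + (-t) * a) / t" using b t by (simp add: field_simps)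
  then have "t * N / (1 + (-t) * a) \<le> D" using t D ta by (simp add: field_simps)
  then have le: "trace_inv Bb - (-t) * N / (1 + (-t) * a) \<le> trace_inv Bs" by (simp add: D_def)
  have upd': "C *\<^sub>v y = Bb *\<^sub>v y + (complex_of_real (-t) * (y \<bullet>c v)) \<cdot>\<^sub>v v"
    if "y \<in> carrier_vec m" for y
    using upd[OF that] Bb v that by (auto simp: vec_eq_iff)
  show "positive_definite C"
    by (rule pd_rank_one_update[OF Bb C v(1) upd']) (use ta in \<open>auto simp: a_def\<close>)
  have "trace_inv C = trace_inv Bb - (-t) * N / (1 + (-t) * a)"
    unfolding N_def a_def
    by (rule trace_inv_rank_one_update[OF Bb C v(1) upd']) (use ta in \<open>auto simp: a_def\<close>)
  then show "trace_inv C \<le> trace_inv Bs" using le by simp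
qed

text \<open>Here \<open>Bb = M - l I\<close>, and \<open>Bs\<close> is the same matrix for the raised barrier.\<close>
lemma lower_barrier_step:
  assumes Bs: "Bs \<in> carrier_mat m m" "positive_definite Bs"
    and gap: "trace_inv Bb < trace_inv Bs"
    and C: "C \<in> carrier_mat m m" and v: "v \<in> carrier_vec m" and t: "0 < t"
    and upd: "\<And>y. y \<in> carrier_vec m \<Longrightarrow> C *\<^sub>v y = Bs *\<^sub>v y + (complex_of_real t * (y \<bullet>c v)) \<cdot>\<^sub>v v"
    and bound: "1 / t \<le> sq_norm (minv Bs *\<^sub>v v) / (trace_inv Bs - trace_inv Bb) - Re ((minv Bs *\<^sub>v v) \<bullet>c v)"
  shows "positive_definite C" and "trace_inv C \<le> trace_inv Bb"
proof -
  define N a D where "N = sq_norm (minv Bs *\<^sub>v v)" and "a = Re ((minv Bs *\<^sub>v v) \<bullet>c v)"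
    and "D = trace_inv Bs - trace_inv Bb"
  have D: "0 < D" using gap by (simp add: D_def)
  have a: "0 \<le> a" unfolding a_def
    by (rule pd_nonneg[OF minv_carrier[OF Bs] minv_positive_definite[OF Bs] v])
  then have ta: "0 < 1 + t * a" using t by (simp add: add_pos_nonneg)
  have b: "1 / t + a \<le> N / D" using bound by (simp add: N_def a_def D_def)
  have "(1 + t * a) / t \<le> N / D" using b t by (simp add: field_simps)
  then have "D \<le> t * N / (1 + t * a)" using t D ta by (simp add: field_simps)
  then have le: "trace_inv Bs - t * N / (1 + t * a) \<le> trace_inv Bb" by (simp add: D_def)
  show "positive_definite C"
    by (rule pd_rank_one_update[OF Bs C v upd]) (use ta in \<open>auto simp: a_def\<close>)
  have "trace_inv C = trace_inv Bs - t * N / (1 + t * a)"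
    unfolding N_def a_def
    by (rule trace_inv_rank_one_update[OF Bs C v upd]) (use ta in \<open>auto simp: a_def\<close>)
  then show "trace_inv C \<le> trace_inv Bb" using le by simp
qed

section \<open>Isotropic families of vectors\<close>

text \<open>The rank-one matrices \<open>V x (V x)\<^sup>*\<close> integrate to the identity matrix.\<close>
definition isotropic :: "'a measure \<Rightarrow> nat \<Rightarrow> ('a \<Rightarrow> complex vec) \<Rightarrow> bool" where
  "isotropic \<nu> m V \<longleftrightarrow> (\<forall>x. V x \<in> carrier_vec m) \<and>
     (\<forall>a<m. \<forall>b<m. has_bochner_integral \<nu> (\<lambda>x. vec_index (V x) a * cnj (vec_index (V x) b))
        (if a = b then 1 else 0))"

lemma isotropic_carrier: "isotropic \<nu> m V \<Longrightarrow> V x \<in> carrier_vec m"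
  by (simp add: isotropic_def)

text \<open>The integral of the quadratic form of \<open>T\<close> is the trace of \<open>T\<close>.\<close>
lemma isotropic_form:
  assumes V: "isotropic \<nu> m V" and T: "T \<in> carrier_mat m m"
  shows "has_bochner_integral \<nu> (\<lambda>x. Re ((T *\<^sub>v V x) \<bullet>c V x))
    (\<Sum>j<m. Re ((T *\<^sub>v unit_vec m j) \<bullet>c unit_vec m j))"
proof -
  have "has_bochner_integral \<nu> (\<lambda>x. \<Sum>a<m. \<Sum>b<m. T $$ (a, b) * (vec_index (V x) b * cnj (vec_index (V x) a)))
      (\<Sum>a<m. \<Sum>b<m. T $$ (a, b) * (if b = a then 1 else 0))"
    using V unfolding isotropic_def
    by (intro has_bochner_integral_sum has_bochner_integral_mult_right) auto
  moreover have "(\<Sum>a<m. \<Sum>b<m. T $$ (a, b) * (vec_index (V x) b * cnj (vec_index (V x) a))) = (T *\<^sub>v V x) \<bullet>c V x" for x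
    using isotropic_carrier[OF V] T by (simp add: cip_mult_mat_vec_sum mult.assoc)
  moreover have "(\<Sum>a<m. \<Sum>b<m. T $$ (a, b) * (if b = a then 1 else 0)) =
      (\<Sum>j<m. (T *\<^sub>v unit_vec m j) \<bullet>c unit_vec m j)"
    by (intro sum.cong refl) (simp only: mult_mat_unit_vec[OF T] lessThan_iff, simp add: if_distrib if_distribR cong: if_cong)
  ultimately have "has_bochner_integral \<nu> (\<lambda>x. (T *\<^sub>v V x) \<bullet>c V x)
      (\<Sum>j<m. (T *\<^sub>v unit_vec m j) \<bullet>c unit_vec m j)" by simp
  from has_bochner_integral_bounded_linear[OF bounded_linear_Re this]
  show ?thesis by (simp add: o_def)
qed

lemma isotropic_trace_inv:
  assumes V: "isotropic \<nu> m V" and B: "B \<in> carrier_mat m m" "positive_definite B"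
  shows "has_bochner_integral \<nu> (\<lambda>x. Re ((minv B *\<^sub>v V x) \<bullet>c V x)) (trace_inv B)"
  using isotropic_form[OF V minv_carrier[OF B]] B by (simp add: trace_inv_eq)

lemma isotropic_inv_frob:
  assumes V: "isotropic \<nu> m V" and B: "B \<in> carrier_mat m m" "positive_definite B"
  shows "has_bochner_integral \<nu> (\<lambda>x. sq_norm (minv B *\<^sub>v V x)) (inv_frob B)"
proof -
  note R = minv_carrier[OF B] minv_positive_definite[OF B]
  have sq: "Re (((minv B * minv B) *\<^sub>v v) \<bullet>c v) = sq_norm (minv B *\<^sub>v v)"
    if v: "v \<in> carrier_vec m" for v
  proof -
    have "((minv B * minv B) *\<^sub>v v) \<bullet>c v = (minv B *\<^sub>v (minv B *\<^sub>v v)) \<bullet>c v"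
      using R v by simp
    also have "\<dots> = (minv B *\<^sub>v v) \<bullet>c (minv B *\<^sub>v v)"
      by (rule pd_sym[OF R minv_vec(1)[OF B v] v])
    finally show ?thesis by (simp add: cip_self)
  qed
  have "minv B * minv B \<in> carrier_mat m m" using R by simp
  from isotropic_form[OF V this] show ?thesis
    using B isotropic_carrier[OF V] by (simp add: sq inv_frob_def)
qed

lemma isotropic_sq_norm:
  assumes V: "isotropic \<nu> m V"
  shows "has_bochner_integral \<nu> (\<lambda>x. sq_norm (V x)) (real m)"
proof -
  have "Re ((1\<^sub>m m *\<^sub>v unit_vec m j) \<bullet>c unit_vec m j) = 1" if "j < m" for j
    using that mult_mat_unit_vec[of "1\<^sub>m m" m j j] by simp
  then show ?thesis
    using isotropic_form[OF V one_carrier_mat] isotropic_carrier[OF V] by (simp add: cip_self)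
qed

text \<open>An inequality between integrals holds between the integrands at some point, and even at
  one with \<open>V x \<noteq> 0\<close>: otherwise the integrands would agree almost everywhere and \<open>V\<close> would
  vanish almost everywhere, whereas the integral of its squared norm is \<open>m\<close>.\<close>
lemma isotropic_good_point:
  fixes f g :: "'a \<Rightarrow> real"
  assumes V: "isotropic \<nu> m V" and m: "0 < m"
    and f: "has_bochner_integral \<nu> f a" and g: "has_bochner_integral \<nu> g b" and ab: "a \<le> b"
    and zero: "\<And>x. V x = 0\<^sub>v m \<Longrightarrow> f x = g x"
  shows "\<exists>x\<in>space \<nu>. V x \<noteq> 0\<^sub>v m \<and> f x \<le> g x"
proof (rule ccontr)
  assume neg: "\<not> ?thesis"
  have lt: "g x < f x" if "x \<in> space \<nu>" "V x \<noteq> 0\<^sub>v m" for x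
    using neg that by (meson not_le_imp_less)
  have h: "has_bochner_integral \<nu> (\<lambda>x. f x - g x) (a - b)"
    using f g by (rule has_bochner_integral_diff)
  have ge: "AE x in \<nu>. 0 \<le> f x - g x"
    using lt zero by (intro AE_I2) (metis diff_ge_0_iff_ge order_refl less_imp_le)
  then have "0 \<le> a - b"
    using integral_nonneg_AE[OF ge] has_bochner_integral_integral_eq[OF h] by simp
  then have "(\<integral>x. f x - g x \<partial>\<nu>) = 0"
    using ab has_bochner_integral_integral_eq[OF h] by simp
  then have "AE x in \<nu>. f x - g x = 0"
    using integral_nonneg_eq_0_iff_AE[OF integrable.intros[OF h] ge] by simp
  then have "AE x in \<nu>. sq_norm (V x) = 0"
    using AE_space
  proof eventually_elim
    case (elim x)
    then have "V x = 0\<^sub>v m" using lt[of x] by fastforce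
    then show ?case by (simp add: sq_norm_zero)
  qed
  then have "(\<integral>x. sq_norm (V x) \<partial>\<nu>) = 0" by (rule integral_eq_zero_AE)
  then show False
    using has_bochner_integral_integral_eq[OF isotropic_sq_norm[OF V]] m by simp
qed

section \<open>One step of the barrier method\<close>

lemma scalar_shift_mult_vec:
  fixes M :: "complex mat"
  assumes "M \<in> carrier_mat m m" "y \<in> carrier_vec m"
  shows "(c \<cdot>\<^sub>m 1\<^sub>m m - M) *\<^sub>v y = c \<cdot>\<^sub>v y - M *\<^sub>v y"
    and "(M - c \<cdot>\<^sub>m 1\<^sub>m m) *\<^sub>v y = M *\<^sub>v y - c \<cdot>\<^sub>v y"
proof -
  have "(c \<cdot>\<^sub>m 1\<^sub>m m) *\<^sub>v y = c \<cdot>\<^sub>v y"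
    using assms
    by (intro eq_vecI) (auto simp: scalar_prod_def unit_vec_def if_distrib if_distribR cong: if_cong)
  then show "(c \<cdot>\<^sub>m 1\<^sub>m m - M) *\<^sub>v y = c \<cdot>\<^sub>v y - M *\<^sub>v y"
    and "(M - c \<cdot>\<^sub>m 1\<^sub>m m) *\<^sub>v y = M *\<^sub>v y - c \<cdot>\<^sub>v y"
    using assms by (simp_all add: minus_mult_distrib_mat_vec[of _ m m])
qed

text \<open>All eigenvalues of the self-adjoint matrix \<open>M\<close> lie below \<open>u\<close>, and the potential of this
  barrier is at most \<open>e\<close>.\<close>
definition upper_barrier :: "nat \<Rightarrow> real \<Rightarrow> real \<Rightarrow> complex mat \<Rightarrow> bool" where
  "upper_barrier m e u M \<longleftrightarrow> positive_definite (complex_of_real u \<cdot>\<^sub>m 1\<^sub>m m - M) \<and>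
     trace_inv (complex_of_real u \<cdot>\<^sub>m 1\<^sub>m m - M) \<le> e"

text \<open>The same for a barrier \<open>l\<close> below all eigenvalues of \<open>M\<close>.\<close>
definition lower_barrier :: "nat \<Rightarrow> real \<Rightarrow> real \<Rightarrow> complex mat \<Rightarrow> bool" where
  "lower_barrier m e l M \<longleftrightarrow> positive_definite (M - complex_of_real l \<cdot>\<^sub>m 1\<^sub>m m) \<and>
     trace_inv (M - complex_of_real l \<cdot>\<^sub>m 1\<^sub>m m) \<le> e"

text \<open>The barriers move by \<open>dU\<close> and \<open>dL\<close>, and the bounds \<open>eU\<close> and \<open>eL\<close> on the potentials persist.
  The matrix \<open>M'\<close> is \<open>M + t V x (V x)\<^sup>*\<close>.\<close>
lemma barrier_step:
  fixes u l dU dL eU eL :: real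
  assumes V: "isotropic \<nu> m V" and m: "0 < m" and M: "M \<in> carrier_mat m m"
    and up: "upper_barrier m eU u M" and low: "lower_barrier m eL l M"
    and dU: "0 < dU" and dL: "0 < dL" and small: "dL * eL < 1"
    and balance: "1 / dU + eU \<le> 1 / dL - eL"
  shows "\<exists>x\<in>space \<nu>. \<exists>t>0. \<forall>M'\<in>carrier_mat m m.
    (\<forall>y\<in>carrier_vec m. M' *\<^sub>v y = M *\<^sub>v y + (complex_of_real t * (y \<bullet>c V x)) \<cdot>\<^sub>v V x) \<longrightarrow>
    upper_barrier m eU (u + dU) M' \<and> lower_barrier m eL (l + dL) M'"
proof -
  define I where "I = (\<lambda>c. complex_of_real c \<cdot>\<^sub>m (1\<^sub>m m :: complex mat))"
  have Ic: "I c \<in> carrier_mat m m" for c by (simp add: I_def)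
  define Us Ub Ls Lb where "Us = I u - M" and "Ub = I (u + dU) - M"
    and "Ls = M - I (l + dL)" and "Lb = M - I l"
  have car: "Us \<in> carrier_mat m m" "Ub \<in> carrier_mat m m" "Ls \<in> carrier_mat m m" "Lb \<in> carrier_mat m m"
    unfolding Us_def Ub_def Ls_def Lb_def by (rule minus_carrier_mat M Ic)+
  have mv: "Us *\<^sub>v y = of_real u \<cdot>\<^sub>v y - M *\<^sub>v y" "Ub *\<^sub>v y = of_real (u + dU) \<cdot>\<^sub>v y - M *\<^sub>v y"
    "Ls *\<^sub>v y = M *\<^sub>v y - of_real (l + dL) \<cdot>\<^sub>v y" "Lb *\<^sub>v y = M *\<^sub>v y - of_real l \<cdot>\<^sub>v y"
    if "y \<in> carrier_vec m" for y
    using scalar_shift_mult_vec[OF M that] by (simp_all add: Us_def Ub_def Ls_def Lb_def I_def)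
  have shU: "Ub *\<^sub>v y = Us *\<^sub>v y + complex_of_real dU \<cdot>\<^sub>v y" if y: "y \<in> carrier_vec m" for y
    unfolding mv[OF y] using y M by (intro eq_vecI) (auto simp: algebra_simps)
  have shL: "Lb *\<^sub>v y = Ls *\<^sub>v y + complex_of_real dL \<cdot>\<^sub>v y" if y: "y \<in> carrier_vec m" for y
    unfolding mv[OF y] using y M by (intro eq_vecI) (auto simp: algebra_simps)
  have Us: "positive_definite Us" "trace_inv Us \<le> eU" and Lb: "positive_definite Lb" "trace_inv Lb \<le> eL"
    using up low by (auto simp: upper_barrier_def lower_barrier_def Us_def Lb_def I_def)
  have Ub: "positive_definite Ub"
    unfolding positive_definite_iff[OF car(2)]
  proof (intro conjI ballI impI)
    fix v w :: "complex vec" assume v: "v \<in> carrier_vec m" and w: "w \<in> carrier_vec m"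
    show "(Ub *\<^sub>v v) \<bullet>c w = v \<bullet>c (Ub *\<^sub>v w)"
      using v w car pd_sym[OF car(1) Us(1) v w] by (simp add: shU cip_linear[of _ m])
  next
    fix v :: "complex vec" assume v: "v \<in> carrier_vec m" "v \<noteq> 0\<^sub>v m"
    have "Re ((Ub *\<^sub>v v) \<bullet>c v) = Re ((Us *\<^sub>v v) \<bullet>c v) + dU * sq_norm v"
      using v car by (simp add: shU cip_linear[of _ m] cip_self)
    moreover have "0 < Re ((Us *\<^sub>v v) \<bullet>c v)" by (rule pd_pos[OF car(1) Us(1) v])
    ultimately show "0 < Re ((Ub *\<^sub>v v) \<bullet>c v)"
      using dU sq_norm_nonneg[of v] by (simp add: add_pos_nonneg)
  qed
  have "dL * trace_inv Lb \<le> dL * eL" using Lb dL by simp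
  then have small': "dL * trace_inv Lb < 1" using small by simp
  have Ls: "positive_definite Ls" by (rule pd_shift_down[OF car(4) Lb(1) car(3) shL dL small'])
  have gapU: "trace_inv Ub < trace_inv Us"
    by (rule trace_inv_mono[OF car(1) Us(1) car(2) Ub shU m dU])
  have gapL: "trace_inv Lb < trace_inv Ls"
    by (rule trace_inv_mono[OF car(3) Ls car(4) Lb(1) shL m dL])
  define f where "f x = sq_norm (minv Ub *\<^sub>v V x) / (trace_inv Us - trace_inv Ub) + Re ((minv Ub *\<^sub>v V x) \<bullet>c V x)" for x
  define g where "g x = sq_norm (minv Ls *\<^sub>v V x) / (trace_inv Ls - trace_inv Lb) - Re ((minv Ls *\<^sub>v V x) \<bullet>c V x)" for x
  have f: "has_bochner_integral \<nu> f (inv_frob Ub / (trace_inv Us - trace_inv Ub) + trace_inv Ub)"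
    unfolding f_def using isotropic_inv_frob[OF V car(2) Ub] isotropic_trace_inv[OF V car(2) Ub]
    by (intro has_bochner_integral_add has_bochner_integral_divide_zero) auto
  have g: "has_bochner_integral \<nu> g (inv_frob Ls / (trace_inv Ls - trace_inv Lb) - trace_inv Ls)"
    unfolding g_def using isotropic_inv_frob[OF V car(3) Ls] isotropic_trace_inv[OF V car(3) Ls]
    by (intro has_bochner_integral_diff has_bochner_integral_divide_zero) auto
  have le: "inv_frob Ub / (trace_inv Us - trace_inv Ub) + trace_inv Ub
      \<le> inv_frob Ls / (trace_inv Ls - trace_inv Lb) - trace_inv Ls"
    using upper_average[OF car(1) Us(1) car(2) Ub shU m dU]
      lower_average[OF car(3) Ls car(4) Lb(1) shL m dL less_imp_le[OF small']] Us(2) Lb(2) balance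
    by linarith
  have zero: "A *\<^sub>v 0\<^sub>v m = 0\<^sub>v m" if "A \<in> carrier_mat m m" for A :: "complex mat"
    using that by (intro eq_vecI) auto
  have "f x = g x" if "V x = 0\<^sub>v m" for x
    unfolding f_def g_def that zero[OF minv_carrier[OF car(2) Ub]] zero[OF minv_carrier[OF car(3) Ls]]
    by (simp add: sq_norm_zero cip_sum[of _ m])
  from isotropic_good_point[OF V m f g le this]
  obtain x where x: "x \<in> space \<nu>" "V x \<noteq> 0\<^sub>v m" "f x \<le> g x" by blast
  have Vx: "V x \<in> carrier_vec m" by (rule isotropic_carrier[OF V])
  have "0 < Re ((minv Ub *\<^sub>v V x) \<bullet>c V x)"
    by (rule pd_pos[OF minv_carrier[OF car(2) Ub] minv_positive_definite[OF car(2) Ub] Vx x(2)])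
  moreover have "0 \<le> sq_norm (minv Ub *\<^sub>v V x) / (trace_inv Us - trace_inv Ub)"
    using gapU sq_norm_nonneg by simp
  ultimately have fpos: "0 < f x" unfolding f_def by linarith
  (* any t with f x \<le> 1 / t \<le> g x would do *)
  define t where "t = 1 / f x"
  have t: "0 < t" "1 / t = f x" using fpos by (auto simp: t_def)
  show ?thesis
  proof (intro bexI[OF _ x(1)] exI[of _ t] conjI ballI impI)
    show "0 < t" by (rule t)
  next
    fix M' :: "complex mat" assume M': "M' \<in> carrier_mat m m"
      and u: "\<forall>y\<in>carrier_vec m. M' *\<^sub>v y = M *\<^sub>v y + (complex_of_real t * (y \<bullet>c V x)) \<cdot>\<^sub>v V x"
    have C1: "I (u + dU) - M' \<in> carrier_mat m m" and C2: "M' - I (l + dL) \<in> carrier_mat m m"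
      by (rule minus_carrier_mat M' Ic)+
    have upd1: "(I (u + dU) - M') *\<^sub>v y = Ub *\<^sub>v y - (complex_of_real t * (y \<bullet>c V x)) \<cdot>\<^sub>v V x"
      if y: "y \<in> carrier_vec m" for y
      unfolding I_def scalar_shift_mult_vec[OF M' y] mv[OF y] using bspec[OF u y] y M M' Vx
      by (intro eq_vecI) (auto simp: algebra_simps)
    have upd2: "(M' - I (l + dL)) *\<^sub>v y = Ls *\<^sub>v y + (complex_of_real t * (y \<bullet>c V x)) \<cdot>\<^sub>v V x"
      if y: "y \<in> carrier_vec m" for y
      unfolding I_def scalar_shift_mult_vec[OF M' y] mv[OF y] using bspec[OF u y] y M M' Vx
      by (intro eq_vecI) (auto simp: algebra_simps)
    have b1: "sq_norm (minv Ub *\<^sub>v V x) / (trace_inv Us - trace_inv Ub) + Re ((minv Ub *\<^sub>v V x) \<bullet>c V x) \<le> 1 / t"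
      unfolding t(2) f_def by simp
    have b2: "1 / t \<le> sq_norm (minv Ls *\<^sub>v V x) / (trace_inv Ls - trace_inv Lb) - Re ((minv Ls *\<^sub>v V x) \<bullet>c V x)"
      using x(3) unfolding t(2) g_def .
    show "upper_barrier m eU (u + dU) M'"
      using upper_barrier_step[OF car(1) Us(1) car(2) Ub gapU C1 Vx x(2) t(1) upd1 b1] Us(2)
      by (auto simp: upper_barrier_def I_def)
    show "lower_barrier m eL (l + dL) M'"
      using lower_barrier_step[OF car(3) Ls gapL C2 Vx t(1) upd2 b2] Lb(2)
      by (auto simp: lower_barrier_def I_def)
  qed
qed

section \<open>Iterating the step\<close>

text \<open>The matrix \<open>\<Sum>s\<in>S. W s V s (V s)\<^sup>*\<close>. It is indexed by a set of points, so that a point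
  that is selected again only increases a weight.\<close>
definition frame_mat :: "nat \<Rightarrow> ('a \<Rightarrow> complex vec) \<Rightarrow> 'a set \<Rightarrow> ('a \<Rightarrow> real) \<Rightarrow> complex mat" where
  "frame_mat m V S W = mat m m (\<lambda>(a, b). \<Sum>s\<in>S. complex_of_real (W s) *
     (vec_index (V s) a * cnj (vec_index (V s) b)))"

lemma frame_mat_carrier: "frame_mat m V S W \<in> carrier_mat m m"
  by (simp add: frame_mat_def)

lemma frame_mat_mult_vec:
  assumes V: "\<And>s. V s \<in> carrier_vec m" and y: "y \<in> carrier_vec m" and a: "a < m"
  shows "vec_index (frame_mat m V S W *\<^sub>v y) a = (\<Sum>s\<in>S. complex_of_real (W s) * (y \<bullet>c V s) * vec_index (V s) a)"
proof -
  have "vec_index (frame_mat m V S W *\<^sub>v y) a =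
      (\<Sum>b<m. (\<Sum>s\<in>S. complex_of_real (W s) * (vec_index (V s) a * cnj (vec_index (V s) b))) * vec_index y b)"
    using a by (subst mult_mat_vec_sum[OF frame_mat_carrier y a]) (simp add: frame_mat_def)
  also have "\<dots> = (\<Sum>s\<in>S. \<Sum>b<m. complex_of_real (W s) * (vec_index (V s) a * cnj (vec_index (V s) b)) * vec_index y b)"
    unfolding sum_distrib_right by (rule sum.swap)
  also have "\<dots> = (\<Sum>s\<in>S. complex_of_real (W s) * (y \<bullet>c V s) * vec_index (V s) a)"
    using V by (simp add: cip_sum[of _ m] sum_distrib_left sum_distrib_right mult_ac)
  finally show ?thesis .
qed

lemma frame_mat_form:
  assumes V: "\<And>s. V s \<in> carrier_vec m" and y: "y \<in> carrier_vec m" and z: "z \<in> carrier_vec m"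
  shows "(frame_mat m V S W *\<^sub>v y) \<bullet>c z = (\<Sum>s\<in>S. complex_of_real (W s) * (y \<bullet>c V s) * (V s \<bullet>c z))"
proof -
  have "(frame_mat m V S W *\<^sub>v y) \<bullet>c z =
      (\<Sum>a<m. (\<Sum>s\<in>S. complex_of_real (W s) * (y \<bullet>c V s) * vec_index (V s) a) * cnj (vec_index z a))"
    unfolding cip_sum[OF z]
    by (intro sum.cong refl) (simp only: lessThan_iff frame_mat_mult_vec[OF V y])
  also have "\<dots> = (\<Sum>s\<in>S. \<Sum>a<m. complex_of_real (W s) * (y \<bullet>c V s) * vec_index (V s) a * cnj (vec_index z a))"
    unfolding sum_distrib_right by (rule sum.swap)
  also have "\<dots> = (\<Sum>s\<in>S. complex_of_real (W s) * (y \<bullet>c V s) * (V s \<bullet>c z))"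
    unfolding cip_sum[OF z] sum_distrib_left by (simp only: mult.assoc)
  finally show ?thesis .
qed

lemma frame_mat_self_form:
  assumes V: "\<And>s. V s \<in> carrier_vec m" and y: "y \<in> carrier_vec m"
  shows "(frame_mat m V S W *\<^sub>v y) \<bullet>c y = complex_of_real (\<Sum>s\<in>S. W s * (cmod (y \<bullet>c V s))\<^sup>2)"
proof -
  have "V s \<bullet>c y = cnj (y \<bullet>c V s)" for s by (rule cip_commute[OF V y])
  then show ?thesis
    unfolding frame_mat_form[OF V y y] of_real_sum of_real_mult complex_norm_square
    by (simp add: mult.assoc)
qed

lemma frame_mat_symmetric:
  assumes V: "\<And>s. V s \<in> carrier_vec m" and y: "y \<in> carrier_vec m" and z: "z \<in> carrier_vec m"
  shows "(frame_mat m V S W *\<^sub>v y) \<bullet>c z = y \<bullet>c (frame_mat m V S W *\<^sub>v z)"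
proof -
  have "y \<bullet>c (frame_mat m V S W *\<^sub>v z) = cnj ((frame_mat m V S W *\<^sub>v z) \<bullet>c y)"
    by (rule cip_commute[OF y mult_mat_vec_carrier[OF frame_mat_carrier z]])
  also have "\<dots> = (\<Sum>s\<in>S. complex_of_real (W s) * (y \<bullet>c V s) * (V s \<bullet>c z))"
    unfolding frame_mat_form[OF V z y] using cip_cnj[OF V y] cip_cnj[OF z V]
    by (simp add: mult_ac)
  finally show ?thesis using frame_mat_form[OF V y z] by simp
qed

lemma frame_mat_add_point:
  fixes W :: "'a \<Rightarrow> real" and x :: 'a and t :: real
  assumes V: "\<And>s. V s \<in> carrier_vec m" and S: "finite S" and y: "y \<in> carrier_vec m"
  defines "W' \<equiv> \<lambda>s. if s = x then (if x \<in> S then W x else 0) + t else W s"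
  shows "frame_mat m V (insert x S) W' *\<^sub>v y =
    frame_mat m V S W *\<^sub>v y + (complex_of_real t * (y \<bullet>c V x)) \<cdot>\<^sub>v V x" (is "?l = ?r")
proof (rule eq_vecI)
  note c = carrier_matD[OF frame_mat_carrier]
  fix a assume "a < dim_vec ?r"
  then have a: "a < m" using carrier_vecD[OF V, of x] by simp
  let ?F = "\<lambda>W s. complex_of_real (W s) * (y \<bullet>c V s) * vec_index (V s) a"
  have "(\<Sum>s\<in>insert x S. ?F W' s) = ?F W' x + (\<Sum>s\<in>S - {x}. ?F W' s)"
    using S by (rule sum.insert_remove)
  also have "(\<Sum>s\<in>S - {x}. ?F W' s) = (\<Sum>s\<in>S - {x}. ?F W s)"
    by (intro sum.cong) (auto simp: W'_def)
  also have "\<dots> = (\<Sum>s\<in>S. ?F W s) - (if x \<in> S then ?F W x else 0)"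
    using S by (simp add: sum_diff1)
  also have "?F W' x = (if x \<in> S then ?F W x else 0) + of_real t * (y \<bullet>c V x) * vec_index (V x) a"
    by (simp add: W'_def algebra_simps)
  finally have "(\<Sum>s\<in>insert x S. ?F W' s) = (\<Sum>s\<in>S. ?F W s) + of_real t * (y \<bullet>c V x) * vec_index (V x) a"
    by simp
  then show "vec_index ?l a = vec_index ?r a"
    using a carrier_vecD[OF V, of x] c
    by (simp add: frame_mat_mult_vec[OF V y a] del: index_mult_mat_vec)
next
  show "dim_vec ?l = dim_vec ?r"
    using carrier_vecD[OF V, of x] carrier_matD[OF frame_mat_carrier[of m V]] by simp
qed

lemma scalar_barrier:
  assumes C: "C \<in> carrier_mat m m"
    and act: "\<And>y. y \<in> carrier_vec m \<Longrightarrow> C *\<^sub>v y = complex_of_real c \<cdot>\<^sub>v y"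
    and c: "0 < c"
  shows "positive_definite C" and "trace_inv C = m / c"
proof -
  show pd: "positive_definite C"
    unfolding positive_definite_iff[OF C]
    using c sq_norm_pos by (auto simp: act cip_smult[of _ m] cip_self)
  have "minv C *\<^sub>v unit_vec m j = complex_of_real (1 / c) \<cdot>\<^sub>v unit_vec m j" for j
    using c by (intro minv_unique[OF C pd]) (auto simp: act smult_smult_assoc)
  moreover have "unit_vec m j \<bullet>c unit_vec m j = (1::complex)" if "j < m" for j
    using that by (subst cip_unit_vec) auto
  ultimately show "trace_inv C = m / c"
    unfolding trace_inv_eq[OF C] by (simp add: cip_smult[of _ m])
qed

text \<open>The iteration starts with the zero matrix and the barriers \<open>u0\<close> and \<open>- l0\<close>, whose potentials
  are \<open>m / u0\<close> and \<open>m / l0\<close>.\<close>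
lemma barrier_iteration:
  fixes u0 l0 dU dL :: real
  assumes V: "isotropic \<nu> m V" and m: "0 < m"
    and u0: "0 < u0" and l0: "0 < l0" and dU: "0 < dU" and dL: "0 < dL"
    and small: "dL * (m / l0) < 1" and balance: "1 / dU + m / u0 \<le> 1 / dL - m / l0"
  shows "\<exists>S W. finite S \<and> S \<subseteq> space \<nu> \<and> card S \<le> i \<and> (\<forall>s\<in>S. 0 < W s) \<and>
    upper_barrier m (m / u0) (u0 + real i * dU) (frame_mat m V S W) \<and>
    lower_barrier m (m / l0) (real i * dL - l0) (frame_mat m V S W)"
proof (induction i)
  case 0
  let ?M = "frame_mat m V {} (\<lambda>_. 0)"
  note Vc = isotropic_carrier[OF V]
  have M0: "?M *\<^sub>v y = 0\<^sub>v m" if "y \<in> carrier_vec m" for y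
    using carrier_matD[OF frame_mat_carrier[of m V "{}" "\<lambda>_. 0"]]
    by (intro eq_vecI) (simp_all add: frame_mat_mult_vec[OF Vc that] del: index_mult_mat_vec)
  note act = scalar_shift_mult_vec[OF frame_mat_carrier[of m V "{}" "\<lambda>_. 0"]]
  have U: "(complex_of_real u0 \<cdot>\<^sub>m 1\<^sub>m m - ?M) *\<^sub>v y = complex_of_real u0 \<cdot>\<^sub>v y"
    and L: "(?M - complex_of_real (- l0) \<cdot>\<^sub>m 1\<^sub>m m) *\<^sub>v y = complex_of_real l0 \<cdot>\<^sub>v y"
    if "y \<in> carrier_vec m" for y
    unfolding act[OF that] M0[OF that] using that by (intro eq_vecI; simp)+
  have cU: "complex_of_real u0 \<cdot>\<^sub>m 1\<^sub>m m - ?M \<in> carrier_mat m m"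
    and cL: "?M - complex_of_real (- l0) \<cdot>\<^sub>m 1\<^sub>m m \<in> carrier_mat m m"
    by (intro minus_carrier_mat frame_mat_carrier smult_carrier_mat one_carrier_mat)+
  have "upper_barrier m (m / u0) u0 ?M" "lower_barrier m (m / l0) (- l0) ?M"
    using scalar_barrier[OF cU U u0] scalar_barrier[OF cL L l0]
    unfolding upper_barrier_def lower_barrier_def by auto
  then show ?case by (intro exI[of _ "{}"] exI[of _ "\<lambda>_. 0"]) auto
next
  case (Suc i)
  note Vc = isotropic_carrier[OF V]
  from Suc.IH obtain S W where S: "finite S" "S \<subseteq> space \<nu>" "card S \<le> i" and W: "\<forall>s\<in>S. 0 < W s"
    and up: "upper_barrier m (m / u0) (u0 + real i * dU) (frame_mat m V S W)"
    and low: "lower_barrier m (m / l0) (real i * dL - l0) (frame_mat m V S W)"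
    by auto
  from barrier_step[OF V m frame_mat_carrier up low dU dL small balance]
  obtain x t where x: "x \<in> space \<nu>" and t: "0 < t" and step: "\<forall>M'\<in>carrier_mat m m.
      (\<forall>y\<in>carrier_vec m. M' *\<^sub>v y = frame_mat m V S W *\<^sub>v y + (complex_of_real t * (y \<bullet>c V x)) \<cdot>\<^sub>v V x) \<longrightarrow>
      upper_barrier m (m / u0) (u0 + real i * dU + dU) M' \<and> lower_barrier m (m / l0) (real i * dL - l0 + dL) M'"
    by blast
  define W' where "W' = (\<lambda>s. if s = x then (if x \<in> S then W x else 0) + t else W s)"
  have "upper_barrier m (m / u0) (u0 + real i * dU + dU) (frame_mat m V (insert x S) W') \<and>
      lower_barrier m (m / l0) (real i * dL - l0 + dL) (frame_mat m V (insert x S) W')"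
    using step frame_mat_carrier[of m V "insert x S" W'] frame_mat_add_point[where V = V and x = x and W = W and t = t, OF Vc S(1), folded W'_def] by blast
  moreover have "u0 + real i * dU + dU = u0 + real (Suc i) * dU" "real i * dL - l0 + dL = real (Suc i) * dL - l0"
    by (simp_all add: algebra_simps)
  moreover have "\<forall>s\<in>insert x S. 0 < W' s"
    using W t by (auto simp: W'_def add_pos_pos)
  moreover have "card (insert x S) \<le> Suc i"
    using S by (simp add: card_insert_if)
  ultimately show ?case
    using S x by (intro exI[of _ "insert x S"] exI[of _ W']) auto
qed

lemma barrier_bounds:
  assumes M: "M \<in> carrier_mat m m" and v: "v \<in> carrier_vec m"
  shows "upper_barrier m e u M \<Longrightarrow> Re ((M *\<^sub>v v) \<bullet>c v) \<le> u * sq_norm v"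
    and "lower_barrier m e l M \<Longrightarrow> l * sq_norm v \<le> Re ((M *\<^sub>v v) \<bullet>c v)"
proof -
  have c: "complex_of_real u \<cdot>\<^sub>m 1\<^sub>m m - M \<in> carrier_mat m m" "M - complex_of_real l \<cdot>\<^sub>m 1\<^sub>m m \<in> carrier_mat m m"
    by (intro minus_carrier_mat M smult_carrier_mat one_carrier_mat)+
  have Mv: "M *\<^sub>v v \<in> carrier_vec m" using M v by simp
  show "Re ((M *\<^sub>v v) \<bullet>c v) \<le> u * sq_norm v" if "upper_barrier m e u M"
    using pd_nonneg[OF c(1) _ v] that v Mv
    by (simp add: upper_barrier_def scalar_shift_mult_vec[OF M v] cip_linear[of _ m] cip_self)
  show "l * sq_norm v \<le> Re ((M *\<^sub>v v) \<bullet>c v)" if "lower_barrier m e l M"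
    using pd_nonneg[OF c(2) _ v] that v Mv
    by (simp add: lower_barrier_def scalar_shift_mult_vec[OF M v] cip_linear[of _ m] cip_self)
qed

text \<open>The constants are those of Batson, Spielman and Srivastava: they make \<open>balance\<close> an
  equality and give the final ratio \<open>u / l\<close>. Although \<open>l\<close> starts negative, it ends at
  \<open>m r (r - 1) > 0\<close>.\<close>
theorem isotropic_sparsification:
  assumes V: "isotropic \<nu> m V" and m: "0 < m" and n: "m < n"
  defines "r \<equiv> sqrt (real n / real m)"
  shows "\<exists>S W l u. finite S \<and> S \<subseteq> space \<nu> \<and> card S \<le> n \<and> (\<forall>s\<in>S. 0 < W s) \<and>
    0 < l \<and> u = ((r + 1) / (r - 1))\<^sup>2 * l \<and>
    (\<forall>v\<in>carrier_vec m. l * sq_norm v \<le> (\<Sum>s\<in>S. W s * (cmod (v \<bullet>c V s))\<^sup>2) \<and>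
       (\<Sum>s\<in>S. W s * (cmod (v \<bullet>c V s))\<^sup>2) \<le> u * sq_norm v)"
proof -
  have r: "1 < r" using m n by (simp add: r_def)
  have nr: "real n = real m * r\<^sup>2" using m by (simp add: r_def)
  define u0 l0 dU where "u0 = m * (r * (r + 1) / (r - 1))" and "l0 = m * r" and "dU = (r + 1) / (r - 1)"
  have pos: "0 < u0" "0 < l0" "0 < dU"
    using r m by (simp_all add: u0_def l0_def dU_def add_pos_pos)
  have small: "1 * (m / l0) < 1" using r m by (simp add: l0_def)
  have "1 / dU = (r - 1) / (r + 1)" "m / u0 = (r - 1) / (r * (r + 1))" "m / l0 = 1 / r"
    using r m by (simp_all add: u0_def l0_def dU_def)
  moreover have "(r - 1) / (r + 1) + (r - 1) / (r * (r + 1)) = 1 - 1 / r"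
    using r by (simp add: divide_simps) (simp add: algebra_simps)
  ultimately have balance: "1 / dU + m / u0 \<le> 1 / 1 - m / l0" by simp
  obtain S W where S: "finite S" "S \<subseteq> space \<nu>" "card S \<le> n" "\<forall>s\<in>S. 0 < W s"
    and up: "upper_barrier m (m / u0) (u0 + real n * dU) (frame_mat m V S W)"
    and low: "lower_barrier m (m / l0) (real n * 1 - l0) (frame_mat m V S W)"
    using barrier_iteration[where dL = 1, OF V m pos _ small balance, of n] by auto
  define l u where "l = real n * 1 - l0" and "u = u0 + real n * dU"
  have l: "l = m * r * (r - 1)" by (simp add: l_def l0_def nr algebra_simps power2_eq_square)
  then have "0 < l" using r m by simp
  have "u = m * r * (r + 1) * (r + 1) / (r - 1)"
    using r by (simp add: u_def u0_def dU_def nr divide_simps) (simp add: algebra_simps power2_eq_square)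
  then have u: "u = ((r + 1) / (r - 1))\<^sup>2 * l"
    using r by (simp add: l power2_eq_square)
  have "l * sq_norm v \<le> (\<Sum>s\<in>S. W s * (cmod (v \<bullet>c V s))\<^sup>2) \<and>
       (\<Sum>s\<in>S. W s * (cmod (v \<bullet>c V s))\<^sup>2) \<le> u * sq_norm v" if v: "v \<in> carrier_vec m" for v
    using barrier_bounds(1)[OF frame_mat_carrier v up] barrier_bounds(2)[OF frame_mat_carrier v low]
    unfolding frame_mat_self_form[where V = V, OF isotropic_carrier[OF V] v]
    by (simp add: l_def u_def)
  then show ?thesis
    using S \<open>0 < l\<close> u by blast
qed

section \<open>Orthonormal bases of a function space\<close>

lemma sum_fun_apply: "(\<Sum>a\<in>A. f a) x = (\<Sum>a\<in>A. f a x)" for f :: "'b \<Rightarrow> 'a \<Rightarrow> complex"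
  by (induction A rule: infinite_finite_induct) auto

lemma l2_mult_integrable:
  fixes f g :: "'a \<Rightarrow> complex"
  assumes "f \<in> borel_measurable \<nu>" "integrable \<nu> (\<lambda>x. (cmod (f x))\<^sup>2)"
    and "g \<in> borel_measurable \<nu>" "integrable \<nu> (\<lambda>x. (cmod (g x))\<^sup>2)"
  shows "integrable \<nu> (\<lambda>x. cnj (f x) * g x)"
proof (rule Bochner_Integration.integrable_bound)
  show "integrable \<nu> (\<lambda>x. (cmod (f x))\<^sup>2 + (cmod (g x))\<^sup>2)" using assms by simp
  show "(\<lambda>x. cnj (f x) * g x) \<in> borel_measurable \<nu>"
    using assms borel_measurable_continuous_onI[OF continuous_on_cnj[OF continuous_on_id]]
    by (intro borel_measurable_times) (auto intro: measurable_compose)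
  have "cmod (f x) * cmod (g x) \<le> (cmod (f x))\<^sup>2 + (cmod (g x))\<^sup>2" for x
    using sum_squares_bound[of "cmod (f x)" "cmod (g x)"]
      mult_nonneg_nonneg[OF norm_ge_zero[of "f x"] norm_ge_zero[of "g x"]] by linarith
  then show "AE x in \<nu>. norm (cnj (f x) * g x) \<le> norm ((cmod (f x))\<^sup>2 + (cmod (g x))\<^sup>2)"
    by (simp add: norm_mult)
qed

lemma orthonormal_basis_isotropic:
  assumes F: "function_space \<nu> m F" and \<eta>: "orthonormal_basis \<nu> m F \<eta>"
  shows "isotropic \<nu> m (eval_vec m \<eta>)"
  unfolding isotropic_def
proof (intro conjI allI impI)
  show "eval_vec m \<eta> x \<in> carrier_vec m" for x by (simp add: eval_vec_def)
  fix a b assume ab: "a < m" "b < m"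
  have mem: "\<eta> a \<in> F" "\<eta> b \<in> F" using ab \<eta> by (auto simp: orthonormal_basis_def)
  have "integrable \<nu> (\<lambda>x. cnj (\<eta> a x) * \<eta> b x)"
    using F mem unfolding function_space_def by (intro l2_mult_integrable) auto
  moreover have "(\<integral>x. cnj (\<eta> a x) * \<eta> b x \<partial>\<nu>) = l2_inner \<nu> (\<eta> b) (\<eta> a)"
    by (simp add: l2_inner_def mult.commute)
  moreover have "l2_inner \<nu> (\<eta> b) (\<eta> a) = (if a = b then 1 else 0)"
    using \<eta> ab by (auto simp: orthonormal_basis_def)
  ultimately have "has_bochner_integral \<nu> (\<lambda>x. cnj (\<eta> a x) * \<eta> b x) (if a = b then 1 else 0)"
    by (simp add: has_bochner_integral_iff)
  then show "has_bochner_integral \<nu> (\<lambda>x. vec_index (eval_vec m \<eta> x) a * cnj (vec_index (eval_vec m \<eta> x) b))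
      (if a = b then 1 else 0)"
    using ab by (simp add: eval_vec_def)
qed

text \<open>For an orthonormal basis this is Parseval's identity.\<close>
lemma isotropic_norm:
  assumes V: "isotropic \<nu> m V" and c: "c \<in> carrier_vec m"
  shows "(\<integral>x. (cmod (c \<bullet>c V x))\<^sup>2 \<partial>\<nu>) = sq_norm c"
proof -
  (* the matrix T is the rank-one matrix of c, whose trace is the squared norm of c *)
  note M = frame_mat_carrier[of m "\<lambda>_. c" "{()}" "\<lambda>_. 1"]
  let ?T = "frame_mat m (\<lambda>_. c) {()} (\<lambda>_. 1)"
  have f: "Re ((?T *\<^sub>v y) \<bullet>c y) = (cmod (y \<bullet>c c))\<^sup>2" if "y \<in> carrier_vec m" for y
    using frame_mat_self_form[OF c that, of "{()}" "\<lambda>_. 1"] by simp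
  have "cmod (V x \<bullet>c c) = cmod (c \<bullet>c V x)" for x
    using cip_cnj[OF c isotropic_carrier[OF V, of x]] by (metis complex_mod_cnj)
  moreover have "cmod (unit_vec m j \<bullet>c c) = cmod (c \<bullet>c unit_vec m j)" for j
    using cip_cnj[OF c unit_vec_carrier] by (metis complex_mod_cnj)
  ultimately show ?thesis
    using has_bochner_integral_integral_eq[OF isotropic_form[OF V M]]
    by (simp add: f isotropic_carrier[OF V] sum_cip_unit_vec[OF c])
qed

lemma cip_eval_vec:
  "vec m c \<bullet>c eval_vec m \<eta> x = (\<Sum>a<m. cfun_scale (c a) (\<eta> a)) x"
  by (subst cip_sum[of _ m]) (simp_all add: eval_vec_def sum_fun_apply cfun_scale_def)

lemma orthonormal_basis_span:
  assumes \<eta>: "orthonormal_basis \<nu> m F \<eta>" and f: "f \<in> F"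
  obtains c where "f = (\<Sum>a<m. cfun_scale (c a) (\<eta> a))"
proof -
  have inj: "inj_on \<eta> {..<m}"
  proof (rule inj_onI)
    fix i j assume ij: "i \<in> {..<m}" "j \<in> {..<m}" and eq: "\<eta> i = \<eta> j"
    have "l2_inner \<nu> (\<eta> i) (\<eta> j) = 1" using \<eta> ij by (simp add: eq orthonormal_basis_def)
    then show "i = j" using \<eta> ij by (auto simp: orthonormal_basis_def split: if_splits)
  qed
  have "f \<in> cfun.span (\<eta> ` {..<m})" using \<eta> f by (simp add: orthonormal_basis_def)
  then obtain u where "f = (\<Sum>v\<in>\<eta> ` {..<m}. cfun_scale (u v) v)"
    by (auto simp: cfun.span_finite)
  then have "f = (\<Sum>a<m. cfun_scale (u (\<eta> a)) (\<eta> a))"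
    using sum.reindex[OF inj] by (simp add: o_def)
  then show thesis by (rule that)
qed

text \<open>Both vectors are coordinates of the same function, whose \<open>L\<^sub>2\<close> norm is the norm of either.\<close>
lemma orthonormal_basis_change:
  assumes F: "function_space \<nu> m F" and \<eta>: "orthonormal_basis \<nu> m F \<eta>"
    and \<eta>': "orthonormal_basis \<nu> m F \<eta>'"
    and c: "c \<in> carrier_vec m"
  obtains c' where "c' \<in> carrier_vec m" "sq_norm c' = sq_norm c"
    "\<And>x. c' \<bullet>c eval_vec m \<eta>' x = c \<bullet>c eval_vec m \<eta> x"
proof -
  define f where "f = (\<Sum>a<m. cfun_scale (vec_index c a) (\<eta> a))"
  have "f \<in> F"
    using F \<eta> unfolding f_def function_space_def orthonormal_basis_def
    by (auto intro!: cfun.subspace_sum cfun.subspace_scale)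
  from orthonormal_basis_span[OF \<eta>' this] obtain d where d: "f = (\<Sum>a<m. cfun_scale (d a) (\<eta>' a))" .
  have cv: "vec m (vec_index c) = c" using c by auto
  have 1: "c \<bullet>c eval_vec m \<eta> x = f x" for x
    using cip_eval_vec[of m "vec_index c" \<eta> x] unfolding cv f_def .
  have 2: "vec m d \<bullet>c eval_vec m \<eta>' x = f x" for x
    unfolding d by (rule cip_eval_vec)
  show thesis
  proof (rule that[of "vec m d"])
    show "sq_norm (vec m d) = sq_norm c"
      using isotropic_norm[OF orthonormal_basis_isotropic[OF F \<eta>] c]
        isotropic_norm[OF orthonormal_basis_isotropic[OF F \<eta>'], of "vec m d"] by (simp add: 1 2)
  qed (simp_all add: 1 2)
qed

lemma normal_matrix_eq_frame_mat:
  assumes "bij_betw x {..<k} S"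
  shows "normal_matrix m \<eta> k x (\<lambda>i. W (x i)) = frame_mat m (eval_vec m \<eta>) S W"
  unfolding normal_matrix_def frame_mat_def
  by (intro eq_matI) (simp_all add: sum.reindex_bij_betw[OF assms, symmetric])

section \<open>Condition number and iteration count\<close>

lemma cond_number_bounds:
  assumes A: "A \<in> carrier_mat m m" "positive_definite A" and m: "0 < m" and l: "0 < l"
    and low: "\<And>v. v \<in> carrier_vec m \<Longrightarrow> l * sq_norm v \<le> Re ((A *\<^sub>v v) \<bullet>c v)"
    and up: "\<And>v. v \<in> carrier_vec m \<Longrightarrow> Re ((A *\<^sub>v v) \<bullet>c v) \<le> u * sq_norm v"
  shows "1 \<le> cond_number A" and "cond_number A \<le> u / l"
proof -
  define E where "E = {t. eigenvalue A (complex_of_real t)}"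
  have ev: "Im z = 0 \<and> l \<le> Re z \<and> Re z \<le> u" if ev: "eigenvalue A z" for z
  proof -
    from ev obtain v where v: "v \<in> carrier_vec m" "v \<noteq> 0\<^sub>v m" "A *\<^sub>v v = z \<cdot>\<^sub>v v"
      using A by (auto simp: eigenvalue_def eigenvector_def)
    have p: "0 < sq_norm v" by (rule sq_norm_pos[OF v(1,2)])
    have eq: "(A *\<^sub>v v) \<bullet>c v = z * of_real (sq_norm v)"
      unfolding v(3) using v(1) by (simp add: cip_smult[of _ m] cip_self)
    have "Im ((A *\<^sub>v v) \<bullet>c v) = 0" by (subst pd_form_real[OF A v(1)]) simp
    then have "Im z = 0" using p by (simp add: eq)
    moreover have "l \<le> Re z" using low[OF v(1)] p by (simp add: eq)
    moreover have "Re z \<le> u" using up[OF v(1)] p by (simp add: eq)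
    ultimately show ?thesis by simp
  qed
  have fin: "finite E"
  proof -
    have "finite (spectrum A)" using card_finite_spectrum[OF A(1)] by simp
    moreover have "complex_of_real ` E \<subseteq> spectrum A" by (auto simp: E_def spectrum_def)
    ultimately have "finite (complex_of_real ` E)" by (rule rev_finite_subset)
    then show ?thesis by (rule finite_imageD) (simp add: inj_on_def)
  qed
  obtain z where z: "eigenvalue A z"
    using spectrum_non_empty[OF A(1)] m by (auto simp: spectrum_def)
  have "complex_of_real (Re z) = z" using ev[OF z] by (simp add: complex_eq_iff)
  then have ne: "E \<noteq> {}" using z unfolding E_def by (metis empty_Collect_eq)
  have E: "l \<le> t" "t \<le> u" if "t \<in> E" for t using ev[of "complex_of_real t"] that
    by (simp_all add: E_def)
  have bounds: "l \<le> Min E" "Min E \<le> Max E" "Max E \<le> u"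
    using fin ne E by auto
  have k: "cond_number A = Max E / Min E"
    by (simp add: cond_number_def lambda_max_def lambda_min_def E_def)
  show "1 \<le> cond_number A" unfolding k using bounds l by simp
  show "cond_number A \<le> u / l" unfolding k using bounds l by (intro frac_le) auto
qed

lemma cg_rate_bounds:
  fixes r :: real
  assumes r: "1 < r" and k: "1 \<le> cond_number A" "cond_number A \<le> ((r + 1) / (r - 1))\<^sup>2"
  shows "0 \<le> cg_rate A" and "cg_rate A \<le> 1 / r"
proof -
  define s where "s = sqrt (cond_number A)"
  have s1: "1 \<le> s" using k by (simp add: s_def)
  have "s \<le> (r + 1) / (r - 1)" unfolding s_def using k r by (intro real_le_lsqrt) auto
  then have "s * (r - 1) \<le> r + 1" using r by (simp add: field_simps)
  then have "(s - 1) * r \<le> s + 1" by (simp add: algebra_simps)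
  then show "0 \<le> cg_rate A" "cg_rate A \<le> 1 / r"
    using s1 r unfolding cg_rate_def s_def[symmetric] by (simp_all add: field_simps)
qed

lemma n_iter_bound:
  fixes \<delta> \<rho> :: real
  assumes q: "0 \<le> cg_rate A" "cg_rate A \<le> sqrt \<rho>" and \<rho>: "0 < \<rho>" "\<rho> < 1" and \<delta>: "0 < \<delta>" "\<delta> < 1"
  shows "int (n_iter \<delta> A) \<le> \<lceil>2 * ln (\<delta> / 2) / ln \<rho>\<rceil>"
proof -
  define R where "R = 2 * ln (\<delta> / 2) / ln \<rho>"
  have neg: "ln \<rho> < 0" "ln (\<delta> / 2) < 0" using \<rho> \<delta> by (simp_all add: ln_less_zero)
  then have R: "0 < R" by (simp add: R_def divide_neg_neg)
  define i where "i = nat \<lceil>R\<rceil>"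
  have i: "int i = \<lceil>R\<rceil>" "R \<le> real i" using R by (auto simp: i_def)
  have "real i * ln \<rho> \<le> R * ln \<rho>" using i(2) neg by (simp add: mult_right_mono_neg)
  also have "\<dots> = 2 * ln (\<delta> / 2)" using neg by (simp add: R_def)
  finally have "real i * ln (sqrt \<rho>) \<le> ln (\<delta> / 2)" using \<rho> by (simp add: ln_sqrt)
  then have "ln (sqrt \<rho> ^ i) \<le> ln (\<delta> / 2)" using \<rho> by (simp add: ln_realpow)
  then have "sqrt \<rho> ^ i \<le> \<delta> / 2" using \<rho> \<delta> by (subst (asm) ln_le_cancel_iff) auto
  moreover have "cg_rate A ^ i \<le> sqrt \<rho> ^ i" by (rule power_mono[OF q(2,1)])
  ultimately have "2 * cg_rate A ^ i \<le> \<delta>" by simp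
  then have "n_iter \<delta> A \<le> i" unfolding n_iter_def by (rule Least_le)
  then show ?thesis using i(1) by (simp add: R_def)
qed

theorem lemma5p2:
  fixes \<nu> :: "'a measure" and F :: "('a \<Rightarrow> complex) set" and m n :: nat
  assumes "function_space \<nu> m F" and "0 < m" and "m < n"
  shows "\<exists>k (x :: nat \<Rightarrow> 'a) (w :: nat \<Rightarrow> real).
           k \<le> n \<and> inj_on x {..<k} \<and> (\<forall>i<k. x i \<in> space \<nu>) \<and> (\<forall>i<k. 0 < w i) \<and>
           (\<forall>\<eta>. orthonormal_basis \<nu> m F \<eta> \<longrightarrow>
              positive_definite (normal_matrix m \<eta> k x w) \<and>
              (\<forall>\<delta>::real. 0 < \<delta> \<and> \<delta> < 1 \<longrightarrow>
                 int (n_iter \<delta> (normal_matrix m \<eta> k x w))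
                   \<le> \<lceil>2 * ln (\<delta> / 2) / ln (real m / real n)\<rceil>))"
proof (cases "\<exists>\<eta>. orthonormal_basis \<nu> m F \<eta>")
  case False
  (* Gram-Schmidt excludes this case, but this is not needed: there is no basis to test,
     and the empty set of points qualifies. *)
  then show ?thesis by (intro exI[of _ 0]) auto
next
  case True
  note F = assms(1) and m = assms(2) and n = assms(3)
  obtain \<eta>0 where \<eta>0: "orthonormal_basis \<nu> m F \<eta>0" using True by blast
  define r where "r = sqrt (real n / real m)"
  have r: "1 < r" using m n by (simp add: r_def)
  obtain S W l u where S: "finite S" "S \<subseteq> space \<nu>" "card S \<le> n" "\<forall>s\<in>S. 0 < W s"
    and l: "0 < l" and u: "u = ((r + 1) / (r - 1))\<^sup>2 * l"
    and frame: "\<And>v. v \<in> carrier_vec m \<Longrightarrow>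
        l * sq_norm v \<le> (\<Sum>s\<in>S. W s * (cmod (v \<bullet>c eval_vec m \<eta>0 s))\<^sup>2) \<and>
        (\<Sum>s\<in>S. W s * (cmod (v \<bullet>c eval_vec m \<eta>0 s))\<^sup>2) \<le> u * sq_norm v"
    using isotropic_sparsification[OF orthonormal_basis_isotropic[OF F \<eta>0] m n, folded r_def]
    by blast
  obtain x where x: "bij_betw x {..<card S} S"
    using ex_bij_betw_nat_finite[OF S(1)] by (auto simp: atLeast0LessThan)
  (* The frame inequality is carried over from the basis used in the construction. *)
  have main: "positive_definite (normal_matrix m \<eta> (card S) x (\<lambda>i. W (x i))) \<and>
      (\<forall>\<delta>::real. 0 < \<delta> \<and> \<delta> < 1 \<longrightarrow> int (n_iter \<delta> (normal_matrix m \<eta> (card S) x (\<lambda>i. W (x i))))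
         \<le> \<lceil>2 * ln (\<delta> / 2) / ln (real m / real n)\<rceil>)"
    if \<eta>: "orthonormal_basis \<nu> m F \<eta>" for \<eta>
  proof -
    define A where "A = frame_mat m (eval_vec m \<eta>) S W"
    have A: "A \<in> carrier_mat m m" unfolding A_def by (rule frame_mat_carrier)
    have ec: "eval_vec m \<eta> s \<in> carrier_vec m" for s by (simp add: eval_vec_def)
    have bounds: "l * sq_norm v \<le> Re ((A *\<^sub>v v) \<bullet>c v) \<and> Re ((A *\<^sub>v v) \<bullet>c v) \<le> u * sq_norm v"
      if v: "v \<in> carrier_vec m" for v
    proof -
      obtain c where c: "c \<in> carrier_vec m" "sq_norm c = sq_norm v"
        "\<And>x. c \<bullet>c eval_vec m \<eta>0 x = v \<bullet>c eval_vec m \<eta> x"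
        using orthonormal_basis_change[OF F \<eta> \<eta>0 v] by blast
      have "(A *\<^sub>v v) \<bullet>c v = of_real (\<Sum>s\<in>S. W s * (cmod (v \<bullet>c eval_vec m \<eta> s))\<^sup>2)"
        unfolding A_def by (rule frame_mat_self_form[OF ec v])
      then show ?thesis using frame[OF c(1)] by (simp add: c)
    qed
    have pd: "positive_definite A"
      unfolding positive_definite_iff[OF A]
    proof (intro conjI ballI impI)
      fix v w :: "complex vec" assume "v \<in> carrier_vec m" "w \<in> carrier_vec m"
      then show "(A *\<^sub>v v) \<bullet>c w = v \<bullet>c (A *\<^sub>v w)"
        unfolding A_def by (rule frame_mat_symmetric[OF ec])
    next
      fix v :: "complex vec" assume v: "v \<in> carrier_vec m" "v \<noteq> 0\<^sub>v m"
      have "0 < l * sq_norm v" using l sq_norm_pos[OF v] by simp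
      then show "0 < Re ((A *\<^sub>v v) \<bullet>c v)" using bounds[OF v(1)] by linarith
    qed
    have "1 \<le> cond_number A" "cond_number A \<le> u / l"
      using cond_number_bounds[OF A pd m l] bounds by blast+
    then have q: "0 \<le> cg_rate A" "cg_rate A \<le> 1 / r"
      using cg_rate_bounds[OF r, of A] l by (simp_all add: u)
    have "1 / r = sqrt (real m / real n)"
      by (simp add: r_def real_sqrt_divide)
    then have "int (n_iter \<delta> A) \<le> \<lceil>2 * ln (\<delta> / 2) / ln (real m / real n)\<rceil>"
      if "0 < \<delta>" "\<delta> < 1" for \<delta> :: real
      using n_iter_bound[of A "real m / real n" \<delta>] q m n that by simp
    then show ?thesis
      unfolding normal_matrix_eq_frame_mat[OF x] A_def[symmetric] using pd by blast
  qed
  show ?thesis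
  proof (intro exI conjI allI impI)
    show "card S \<le> n" by (rule S)
    show "inj_on x {..<card S}" using x by (rule bij_betw_imp_inj_on)
    show "x i \<in> space \<nu>" if "i < card S" for i using bij_betwE[OF x] S(2) that by blast
    show "0 < W (x i)" if "i < card S" for i using bij_betwE[OF x] S(4) that by blast
  qed (use main in blast)+
qed

end
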